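(* For every $\varepsilon>0$, there is a polynomial time algorithm (an adaptation of the primal-dual water-filling algorithm) that is a $(2+\varepsilon)$-approximation for the Non-Linear Knapsack-Cover problem with arbitrary non-decreasing cost functions given in the oracle model: it outputs a feasible $x$ of cost at most $(2+\varepsilon)$ times the optimum.
   Context: Non-Linear Knapsack-Cover problem: given a finite set $N$ of $n$ items, a demand $D\in\mathbb{N}$, an integer $m$ (not necessarily polynomially bounded), and for each $i\in N$ an arbitrary non-decreasing function $f_i:\{0,1,\dots,m\}\to\mathbb{Q}_{\ge0}\cup\{\infty\}$, choose $x\in\{0,\dots,m\}^N$ with $\sum_ix_i\ge D$ minimizing $\sum_if_i(x_i)$; the instance is assumed feasible. Oracle model: each $f_i$ is given by an oracle returning $f_i(x)$ for any queried $x$, and all values $f_i(x)$ are describable with a polynomial number of bits; polynomial time means polynomial in $n$, $\log m$, $\log D$ and this bit length. *)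

theory Defs
  imports
    Complex_Main
    "HOL-Library.Extended"
    "HOL-Library.FuncSet"
    "HOL-Library.Log_Nat"
    "HOL-Computational_Algebra.Polynomial"
begin

section \<open>Oracle random access machines with logarithmic cost\<close>

text \<open>
  Polynomial time is understood on the random access machine with the logarithmic cost
  criterion, extended by oracle queries and presented as a language of while programs.
  The memory consists of regions of natural numbers, each indexed by the natural numbers; a
  program can only mention finitely many regions, and within a region addresses are computed.
  Every number that occurs as the value of a subexpression or in an oracle answer is charged
  its binary length. This model and Turing machines simulate each other with polynomial overhead.
\<close>

type_synonym mem = "nat \<Rightarrow> nat \<Rightarrow> nat"

type_synonym oracle_fn = "nat \<Rightarrow> nat \<Rightarrow> nat \<times> nat"

abbreviation bits :: "nat \<Rightarrow> nat" where
  "bits k \<equiv> floorlog 2 k"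

datatype aexp =
    Const nat
  | Load nat aexp
  | Add aexp aexp
  | Sub aexp aexp
  | Mul aexp aexp
  | Div aexp aexp

fun aval :: "aexp \<Rightarrow> mem \<Rightarrow> nat" where
  "aval (Const k) M = k"
| "aval (Load a e) M = M a (aval e M)"
| "aval (Add e1 e2) M = aval e1 M + aval e2 M"
| "aval (Sub e1 e2) M = aval e1 M - aval e2 M"
| "aval (Mul e1 e2) M = aval e1 M * aval e2 M"
| "aval (Div e1 e2) M = aval e1 M div aval e2 M"

fun acost :: "aexp \<Rightarrow> mem \<Rightarrow> nat" where
  "acost (Const k) M = 1 + bits k"
| "acost (Load a e) M = acost e M + 1 + bits (aval (Load a e) M)"
| "acost (Add e1 e2) M = acost e1 M + acost e2 M + 1 + bits (aval (Add e1 e2) M)"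
| "acost (Sub e1 e2) M = acost e1 M + acost e2 M + 1 + bits (aval (Sub e1 e2) M)"
| "acost (Mul e1 e2) M = acost e1 M + acost e2 M + 1 + bits (aval (Mul e1 e2) M)"
| "acost (Div e1 e2) M = acost e1 M + acost e2 M + 1 + bits (aval (Div e1 e2) M)"

datatype com =
    Skip
  | Store nat aexp aexp
  | Query nat aexp aexp
  | Seq com com
  | Ite aexp com com
  | While aexp com

definition upd :: "mem \<Rightarrow> nat \<Rightarrow> nat \<Rightarrow> nat \<Rightarrow> mem" where
  "upd M a i v = M(a := (M a)(i := v))"

text \<open>
  \<open>exec \<Omega> c M t M'\<close>: started in \<open>M\<close> with oracle \<open>\<Omega>\<close>, the program \<open>c\<close> halts after time \<open>t\<close> in \<open>M'\<close>.
  A guard counts as true if its value is nonzero. \<open>Query a e1 e2\<close> writes the two components of the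
  answer to cells 0 and 1 of region \<open>a\<close>.
\<close>

inductive exec :: "oracle_fn \<Rightarrow> com \<Rightarrow> mem \<Rightarrow> nat \<Rightarrow> mem \<Rightarrow> bool" for \<Omega> where
  Skip: "exec \<Omega> Skip M 1 M"
| Store: "exec \<Omega> (Store a e1 e2) M (1 + acost e1 M + acost e2 M) (upd M a (aval e1 M) (aval e2 M))"
| Query: "\<Omega> (aval e1 M) (aval e2 M) = (p, q) \<Longrightarrow>
    exec \<Omega> (Query a e1 e2) M (1 + acost e1 M + acost e2 M + bits p + bits q)
      (upd (upd M a 0 p) a 1 q)"
| Seq: "exec \<Omega> c1 M t1 M' \<Longrightarrow> exec \<Omega> c2 M' t2 M'' \<Longrightarrow> exec \<Omega> (Seq c1 c2) M (t1 + t2) M''"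
| IteTrue: "aval e M \<noteq> 0 \<Longrightarrow> exec \<Omega> c1 M t M' \<Longrightarrow> exec \<Omega> (Ite e c1 c2) M (1 + acost e M + t) M'"
| IteFalse: "aval e M = 0 \<Longrightarrow> exec \<Omega> c2 M t M' \<Longrightarrow> exec \<Omega> (Ite e c1 c2) M (1 + acost e M + t) M'"
| WhileTrue: "aval e M \<noteq> 0 \<Longrightarrow> exec \<Omega> c M t1 M' \<Longrightarrow> exec \<Omega> (While e c) M' t2 M'' \<Longrightarrow>
    exec \<Omega> (While e c) M (1 + acost e M + t1 + t2) M''"
| WhileFalse: "aval e M = 0 \<Longrightarrow> exec \<Omega> (While e c) M (1 + acost e M) M"

inductive_cases exec_SkipE: "exec \<Omega> Skip M t M'"
inductive_cases exec_StoreE: "exec \<Omega> (Store a e1 e2) M t M'"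
inductive_cases exec_QueryE: "exec \<Omega> (Query a e1 e2) M t M'"
inductive_cases exec_SeqE: "exec \<Omega> (Seq c1 c2) M t M'"
inductive_cases exec_IteE: "exec \<Omega> (Ite e c1 c2) M t M'"
inductive_cases exec_WhileE: "exec \<Omega> (While e c) M t M'"

lemma exec_deterministic:
  "exec \<Omega> c M t M' \<Longrightarrow> exec \<Omega> c M u M'' \<Longrightarrow> u = t \<and> M'' = M'"
proof (induction arbitrary: u M'' rule: exec.induct)
  case Skip
  then show ?case by (auto elim: exec_SkipE)
next
  case Store
  then show ?case by (auto elim: exec_StoreE)
next
  case Query
  then show ?case by (auto elim!: exec_QueryE)
next
  case (Seq c1 M t1 M' c2 t2 M3)
  from Seq.prems obtain u1 u2 N where "exec \<Omega> c1 M u1 N" "exec \<Omega> c2 N u2 M''" "u = u1 + u2"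
    by (rule exec_SeqE)
  with Seq.IH(1)[of u1 N] Seq.IH(2)[of u2 M''] show ?case by simp
next
  case (IteTrue e M c1 t M' c2)
  from IteTrue.prems IteTrue.hyps obtain v where "u = 1 + acost e M + v" "exec \<Omega> c1 M v M''"
    by (auto elim: exec_IteE)
  with IteTrue.IH[of v M''] show ?case by simp
next
  case (IteFalse e M c2 t M' c1)
  from IteFalse.prems IteFalse.hyps obtain v where "u = 1 + acost e M + v" "exec \<Omega> c2 M v M''"
    by (auto elim: exec_IteE)
  with IteFalse.IH[of v M''] show ?case by simp
next
  case (WhileTrue e M c t1 M' t2 M3)
  from WhileTrue.prems WhileTrue.hyps(1) obtain u1 N u2 where
    "u = 1 + acost e M + u1 + u2" "exec \<Omega> c M u1 N" "exec \<Omega> (While e c) N u2 M''"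
    by (cases rule: exec.cases) auto
  with WhileTrue.IH(1)[of u1 N] WhileTrue.IH(2)[of u2 M''] show ?case by simp
next
  case (WhileFalse e M c)
  from WhileFalse.prems show ?case
    by (rule exec_WhileE) (use WhileFalse.hyps in simp_all)
qed


section \<open>The Non-Linear Knapsack-Cover problem\<close>

text \<open>
  The items are \<open>0, \<dots>, n - 1\<close>. Only the values \<open>f i x\<close> with \<open>i < n\<close> and \<open>x \<le> m\<close> belong to the
  instance. The others are unconstrained, so an algorithm can rely neither on them nor on their
  binary length.
\<close>

type_synonym costs = "nat \<Rightarrow> nat \<Rightarrow> rat extended"

definition feasible :: "nat \<Rightarrow> nat \<Rightarrow> nat \<Rightarrow> (nat \<Rightarrow> nat) set" where
  "feasible n m D = {x \<in> {..<n} \<rightarrow>\<^sub>E {..m}. D \<le> (\<Sum>i<n. x i)}"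

definition nlkc_instance :: "nat \<Rightarrow> nat \<Rightarrow> nat \<Rightarrow> costs \<Rightarrow> bool" where
  "nlkc_instance n m D f \<longleftrightarrow>
     (\<forall>i<n. (\<forall>x\<le>m. 0 \<le> f i x) \<and> mono_on {..m} (f i)) \<and> feasible n m D \<noteq> {}"

definition cost :: "nat \<Rightarrow> costs \<Rightarrow> (nat \<Rightarrow> nat) \<Rightarrow> rat extended" where
  "cost n f x = (\<Sum>i<n. f i (x i))"

definition opt :: "nat \<Rightarrow> nat \<Rightarrow> nat \<Rightarrow> costs \<Rightarrow> rat extended" where
  "opt n m D f = Min (cost n f ` feasible n m D)"

text \<open>The factor \<open>r\<close> is real whereas costs are rational, hence the comparison in the extended
  reals; \<open>r\<close> times infinity is infinity.\<close>

definition approx_solution :: "real \<Rightarrow> nat \<Rightarrow> nat \<Rightarrow> nat \<Rightarrow> costs \<Rightarrow> (nat \<Rightarrow> nat) \<Rightarrow> bool" where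
  "approx_solution r n m D f x \<longleftrightarrow>
     x \<in> feasible n m D \<and>
     map_extended of_rat (cost n f x) \<le> map_extended (\<lambda>v. r * of_rat v) (opt n m D f)"


section \<open>Approximation algorithms in the oracle model\<close>

text \<open>Values are given as reduced fractions, infinity as the pair \<open>(1, 0)\<close>. The value \<open>Minf\<close> does
  not occur in instances.\<close>

fun encode :: "rat extended \<Rightarrow> nat \<times> nat" where
  "encode (Fin q) = (nat (fst (quotient_of q)), nat (snd (quotient_of q)))"
| "encode Pinf = (1, 0)"
| "encode Minf = (0, 0)"

definition value_bits :: "rat extended \<Rightarrow> nat" where
  "value_bits v = bits (fst (encode v)) + bits (snd (encode v))"

definition max_value_bits :: "nat \<Rightarrow> nat \<Rightarrow> costs \<Rightarrow> nat" where
  "max_value_bits n m f = Max (insert 0 {value_bits (f i x) | i x. i < n \<and> x \<le> m})"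

definition cost_oracle :: "costs \<Rightarrow> oracle_fn" where
  "cost_oracle f i x = encode (f i x)"

text \<open>The input is in cells 0, 1, 2 of region 0, the output is expected in region 1.\<close>

definition input_mem :: "nat \<Rightarrow> nat \<Rightarrow> nat \<Rightarrow> mem" where
  "input_mem n m D = upd (upd (upd (\<lambda>a i. 0) 0 0 n) 0 1 m) 0 2 D"

definition output_vec :: "nat \<Rightarrow> mem \<Rightarrow> nat \<Rightarrow> nat" where
  "output_vec n M = restrict (M 1) {..<n}"

text \<open>A bound that is polynomial in the four size parameters is the same as a bound that is
  polynomial in their sum.\<close>

definition poly_time_approximation :: "real \<Rightarrow> com \<Rightarrow> bool" where
  "poly_time_approximation r c \<longleftrightarrow>
     (\<exists>p :: nat poly. \<forall>n m D f. nlkc_instance n m D f \<longrightarrow>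
        (\<exists>t M. exec (cost_oracle f) c (input_mem n m D) t M \<and>
           t \<le> poly p (n + bits m + bits D + max_value_bits n m f) \<and>
           approx_solution r n m D f (output_vec n M)))"

end

theory Submission
  imports Defs
begin

text \<open>
  Instead of water filling, the costs are rounded up to multiples of a scale \<open>\<delta>\<close>, and a dynamic
  program over \<open>K = k * n\<close> cost units decides whether some feasible solution has rounded cost at
  most \<open>K\<close>; the largest amount of an item that \<open>j\<close> units can buy is found by binary search. The scale
  starts so small that a success means cost zero, and doubles until the test succeeds. A solution found
  at scale \<open>\<delta>\<close> costs at most \<open>K * \<delta>\<close>. Since the test failed at \<open>\<delta> / 2\<close>, and rounding adds at most one
  unit per item, the optimum is at least \<open>(K - n) * \<delta> / 2\<close>. The ratio \<open>2 * k / (k - 1)\<close> tends to \<open>2\<close>.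
\<close>

section \<open>Step counts and running time\<close>

text \<open>Both \<open>m\<close> and \<open>D\<close> may be exponential in the input length, so a
  table indexed by amounts is out of reach. Indexing it by rounded cost and maximizing the amount
  keeps it polynomial, because \<open>K\<close> is linear in \<open>n\<close>. The factor 2 comes
  from doubling the scale, the remaining factor k / (k - 1) from the at most \<open>n\<close> units
  lost by rounding. The optimum is never estimated in advance: numerators and denominators of the
  extreme values of each item bound all finite values from above and all nonzero ones from below,
  and the ratio of these bounds has polynomially many bits, so polynomially many doublings suffice.
  An infinite optimum needs separate care: once a scale above all finite values has failed, no
  solution has finite cost, and one last attempt at an infinite scale, coded by denominator zero,
  still delivers a feasible vector.\<close>

lemma bits_le_iff: "bits x \<le> w \<longleftrightarrow> x < 2 ^ w"
  by (metis floorlog_leD floorlog_leI one_less_numeral_iff semiring_norm(76) zero_le)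

lemma bits_mult_le: "bits (x * y) \<le> bits x + bits y"
proof -
  have "x < 2 ^ bits x" "y < 2 ^ bits y"
    by (simp_all flip: bits_le_iff)
  then show ?thesis
    by (simp add: bits_le_iff power_add mult_strict_mono)
qed

lemma bits_le_self: "bits x \<le> x"
  by (simp add: bits_le_iff)

lemma bits_add_le:
  assumes "bits x \<le> w" "bits y \<le> w"
  shows "bits (x + y) \<le> Suc w"
  using assms by (simp add: bits_le_iff)

lemma bits_mono: "x \<le> y \<Longrightarrow> bits x \<le> bits y"
  by (simp add: floorlog_mono)

lemma bits_double: "0 < x \<Longrightarrow> bits (x + x) = Suc (bits x)"
  by (subst compute_floorlog) (simp add: mult_2[symmetric])

lemma upd_apply [simp]: "upd M a i v b = (if b = a then (M a)(i := v) else M b)"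
  by (simp add: upd_def)

section \<open>Syntactic bounds on the length of values and the cost of evaluation\<close>

fun value_size :: "aexp \<Rightarrow> nat" where
  "value_size (Const k) = bits k"
| "value_size (Load a e) = 1"
| "value_size (Add e1 e2) = value_size e1 + value_size e2 + 1"
| "value_size (Sub e1 e2) = value_size e1"
| "value_size (Mul e1 e2) = value_size e1 + value_size e2"
| "value_size (Div e1 e2) = value_size e1"

fun aexp_size :: "aexp \<Rightarrow> nat" where
  "aexp_size (Const k) = 1 + bits k"
| "aexp_size (Load a e) = aexp_size e + 2"
| "aexp_size (Add e1 e2) = aexp_size e1 + aexp_size e2 + 1 + value_size (Add e1 e2)"
| "aexp_size (Sub e1 e2) = aexp_size e1 + aexp_size e2 + 1 + value_size (Sub e1 e2)"
| "aexp_size (Mul e1 e2) = aexp_size e1 + aexp_size e2 + 1 + value_size (Mul e1 e2)"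
| "aexp_size (Div e1 e2) = aexp_size e1 + aexp_size e2 + 1 + value_size (Div e1 e2)"

text \<open>Looks only at subexpressions whose size enters the value: products remain allowed in
  addresses, subtrahends and divisors.\<close>

fun mult_free :: "aexp \<Rightarrow> bool" where
  "mult_free (Const k) \<longleftrightarrow> True"
| "mult_free (Load a e) \<longleftrightarrow> True"
| "mult_free (Add e1 e2) \<longleftrightarrow> mult_free e1 \<and> mult_free e2"
| "mult_free (Sub e1 e2) \<longleftrightarrow> mult_free e1"
| "mult_free (Mul e1 e2) \<longleftrightarrow> False"
| "mult_free (Div e1 e2) \<longleftrightarrow> mult_free e1"

fun stores_mult_free :: "com \<Rightarrow> bool" where
  "stores_mult_free Skip \<longleftrightarrow> True"
| "stores_mult_free (Store a e1 e2) \<longleftrightarrow> mult_free e2"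
| "stores_mult_free (Query a e1 e2) \<longleftrightarrow> True"
| "stores_mult_free (Seq c1 c2) \<longleftrightarrow> stores_mult_free c1 \<and> stores_mult_free c2"
| "stores_mult_free (Ite e c1 c2) \<longleftrightarrow> stores_mult_free c1 \<and> stores_mult_free c2"
| "stores_mult_free (While e c) \<longleftrightarrow> stores_mult_free c"

text \<open>Large enough for two purposes: multiplied by the memory width plus one, it bounds the
  cost of any single step, and by itself it bounds the number of bits by which a step can widen the
  memory.\<close>

fun com_size :: "com \<Rightarrow> nat" where
  "com_size Skip = 1"
| "com_size (Store a e1 e2) = 1 + aexp_size e1 + aexp_size e2 + value_size e2"
| "com_size (Query a e1 e2) = 3 + aexp_size e1 + aexp_size e2"
| "com_size (Seq c1 c2) = com_size c1 + com_size c2"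
| "com_size (Ite e c1 c2) = 1 + aexp_size e + com_size c1 + com_size c2"
| "com_size (While e c) = 1 + aexp_size e + com_size c"

definition bounded_mem :: "nat \<Rightarrow> mem \<Rightarrow> bool" where
  "bounded_mem w M \<longleftrightarrow> (\<forall>a i. bits (M a i) \<le> w)"

lemma bounded_mem_mono: "bounded_mem w M \<Longrightarrow> w \<le> w' \<Longrightarrow> bounded_mem w' M"
  unfolding bounded_mem_def using le_trans by blast

lemma bounded_mem_upd: "bounded_mem w M \<Longrightarrow> bits v \<le> w \<Longrightarrow> bounded_mem w (upd M a i v)"
  by (auto simp: bounded_mem_def)

lemma bits_aval_le:
  assumes "bounded_mem w M"
  shows "bits (aval e M) \<le> value_size e * Suc w"
proof (induction e)
  case (Load a e)
  then show ?case using assms by (simp add: bounded_mem_def le_SucI)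
next
  case (Add e1 e2)
  have "bits (aval e1 M + aval e2 M) \<le> Suc ((value_size e1 + value_size e2) * Suc w)"
    by (rule bits_add_le) (use Add in \<open>auto simp: add_mult_distrib intro: trans_le_add1 trans_le_add2\<close>)
  then show ?case by (simp add: add_mult_distrib)
next
  case (Sub e1 e2)
  then show ?case
    by (auto intro: le_trans[OF bits_mono[OF diff_le_self]])
next
  case (Mul e1 e2)
  then show ?case
    using bits_mult_le[of "aval e1 M" "aval e2 M"] by (simp add: add_mult_distrib)
next
  case (Div e1 e2)
  then show ?case
    by (auto intro: le_trans[OF bits_mono[OF div_le_dividend]])
qed simp

lemma acost_le:
  assumes "bounded_mem w M"
  shows "acost e M \<le> aexp_size e * Suc w"
proof (induction e)
  case (Load a e)
  have "bits (aval (Load a e) M) \<le> w" using assms by (simp add: bounded_mem_def)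
  with Load show ?case by simp
next
  case (Add e1 e2)
  with bits_aval_le[OF assms, of "Add e1 e2"] show ?case by (simp add: add_mult_distrib)
next
  case (Sub e1 e2)
  with bits_aval_le[OF assms, of "Sub e1 e2"] show ?case by (simp add: add_mult_distrib)
next
  case (Mul e1 e2)
  with bits_aval_le[OF assms, of "Mul e1 e2"] show ?case by (simp add: add_mult_distrib)
next
  case (Div e1 e2)
  with bits_aval_le[OF assms, of "Div e1 e2"] show ?case by (simp add: add_mult_distrib)
qed simp

lemma bits_aval_mult_free_le:
  assumes "bounded_mem w M"
  shows "mult_free e \<Longrightarrow> bits (aval e M) \<le> w + value_size e"
proof (induction e)
  case (Load a e)
  then show ?case using assms by (simp add: bounded_mem_def le_SucI)
next
  case (Add e1 e2)
  have "bits (aval e1 M + aval e2 M) \<le> Suc (w + value_size e1 + value_size e2)"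
    by (rule bits_add_le) (use Add in auto)
  then show ?case by simp
next
  case (Sub e1 e2)
  then show ?case
    by (auto intro: le_trans[OF bits_mono[OF diff_le_self]])
next
  case (Div e1 e2)
  then show ?case
    by (auto intro: le_trans[OF bits_mono[OF div_le_dividend]])
qed simp_all

text \<open>Every elementary step counts one, whatever the length of its numbers. A derivation also
  certifies that all oracle answers received have at most \<open>L\<close> bits per
  component.\<close>

inductive run :: "oracle_fn \<Rightarrow> nat \<Rightarrow> com \<Rightarrow> mem \<Rightarrow> nat \<Rightarrow> mem \<Rightarrow> bool" for \<Omega> L where
  Skip: "run \<Omega> L Skip M 1 M"
| Store: "run \<Omega> L (Store a e1 e2) M 1 (upd M a (aval e1 M) (aval e2 M))"
| Query: "\<Omega> (aval e1 M) (aval e2 M) = (p, q) \<Longrightarrow> bits p \<le> L \<Longrightarrow> bits q \<le> L \<Longrightarrow>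
    run \<Omega> L (Query a e1 e2) M 1 (upd (upd M a 0 p) a 1 q)"
| Seq: "run \<Omega> L c1 M k1 M' \<Longrightarrow> run \<Omega> L c2 M' k2 M'' \<Longrightarrow> run \<Omega> L (Seq c1 c2) M (k1 + k2) M''"
| IteTrue: "aval e M \<noteq> 0 \<Longrightarrow> run \<Omega> L c1 M k M' \<Longrightarrow> run \<Omega> L (Ite e c1 c2) M (1 + k) M'"
| IteFalse: "aval e M = 0 \<Longrightarrow> run \<Omega> L c2 M k M' \<Longrightarrow> run \<Omega> L (Ite e c1 c2) M (1 + k) M'"
| WhileTrue: "aval e M \<noteq> 0 \<Longrightarrow> run \<Omega> L c M k1 M' \<Longrightarrow> run \<Omega> L (While e c) M' k2 M'' \<Longrightarrow>
    run \<Omega> L (While e c) M (1 + k1 + k2) M''"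
| WhileFalse: "aval e M = 0 \<Longrightarrow> run \<Omega> L (While e c) M 1 M"

text \<open>If no product is ever stored, a step lengthens the numbers in memory by a constant number of
  bits. Hence a polynomial number of steps takes polynomial time, and the lengths of the individual
  numbers need not be tracked.\<close>

lemma run_imp_exec:
  assumes "run \<Omega> L c M k M'" "stores_mult_free c" "com_size c \<le> G"
    "bounded_mem w M" "L \<le> w" "w + k * G \<le> B"
  shows "\<exists>t. exec \<Omega> c M t M' \<and> t \<le> k * (G * Suc B) \<and> bounded_mem (w + k * G) M'"
  using assms
proof (induction arbitrary: w rule: run.induct)
  case (Skip M)
  then have "1 \<le> G * Suc B" by simp
  moreover have "bounded_mem (w + 1 * G) M"
    using Skip by (auto intro: bounded_mem_mono)
  ultimately show ?case using exec.Skip[of \<Omega> M] by (metis mult_1)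
next
  case (Store a e1 e2 M)
  have B: "bounded_mem B M" using Store by (auto intro: bounded_mem_mono)
  have "1 + acost e1 M + acost e2 M \<le> (1 + aexp_size e1 + aexp_size e2) * Suc B"
    using acost_le[OF B, of e1] acost_le[OF B, of e2] by (simp add: add_mult_distrib)
  also have "\<dots> \<le> G * Suc B" using Store by (intro mult_right_mono) auto
  finally have 1: "1 + acost e1 M + acost e2 M \<le> G * Suc B" .
  have "bounded_mem (w + G) (upd M a (aval e1 M) (aval e2 M))"
  proof (rule bounded_mem_upd)
    show "bounded_mem (w + G) M" using Store by (auto intro: bounded_mem_mono)
    show "bits (aval e2 M) \<le> w + G"
      using bits_aval_mult_free_le[OF \<open>bounded_mem w M\<close>, of e2] Store by auto
  qed
  with 1 exec.Store[of \<Omega> a e1 e2 M] show ?case by (metis mult_1)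
next
  case (Query e1 M e2 p q a)
  have B: "bounded_mem B M" using Query by (auto intro: bounded_mem_mono)
  have "L \<le> B" using Query by simp
  then have "1 + acost e1 M + acost e2 M + bits p + bits q \<le> (3 + aexp_size e1 + aexp_size e2) * Suc B"
    using acost_le[OF B, of e1] acost_le[OF B, of e2] Query.hyps by (simp add: add_mult_distrib)
  also have "\<dots> \<le> G * Suc B" using Query by (intro mult_right_mono) auto
  finally have 1: "1 + acost e1 M + acost e2 M + bits p + bits q \<le> G * Suc B" .
  have "bounded_mem (w + G) (upd (upd M a 0 p) a 1 q)"
    using Query by (intro bounded_mem_upd) (auto intro: bounded_mem_mono)
  with 1 exec.Query[of \<Omega> e1 M e2 p q a, OF Query.hyps(1)] show ?case by (metis mult_1)
next
  case (Seq c1 M k1 M' c2 k2 M'')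
  obtain t1 where t1: "exec \<Omega> c1 M t1 M'" "t1 \<le> k1 * (G * Suc B)" "bounded_mem (w + k1 * G) M'"
    using Seq.IH(1)[of w] Seq.prems by (auto simp: add_mult_distrib)
  \<comment> \<open>The second part starts from a memory that the first has already widened. The
    final width \<open>B\<close> stays fixed and prices every step, so the two times add up.\<close>
  obtain t2 where t2: "exec \<Omega> c2 M' t2 M''" "t2 \<le> k2 * (G * Suc B)" "bounded_mem (w + k1 * G + k2 * G) M''"
    using Seq.IH(2)[OF _ _ t1(3)] Seq.prems by (auto simp: add_mult_distrib)
  have "exec \<Omega> (Seq c1 c2) M (t1 + t2) M''" using t1 t2 exec.Seq by blast
  moreover have "t1 + t2 \<le> (k1 + k2) * (G * Suc B)" using t1(2) t2(2) by (simp only: add_mult_distrib)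
  ultimately show ?case using t2(3) by (auto simp: add_mult_distrib add.assoc)
next
  case (IteTrue e M c1 k M' c2)
  have B: "bounded_mem B M" using IteTrue by (auto intro: bounded_mem_mono)
  obtain t where t: "exec \<Omega> c1 M t M'" "t \<le> k * (G * Suc B)" "bounded_mem (w + k * G) M'"
    using IteTrue.IH[of w] IteTrue.prems by (auto simp: add_mult_distrib)
  have "1 + acost e M \<le> (1 + aexp_size e) * Suc B"
    using acost_le[OF B, of e] by (simp add: add_mult_distrib)
  also have "\<dots> \<le> G * Suc B" using IteTrue by (intro mult_right_mono) auto
  finally have "1 + acost e M + t \<le> (1 + k) * (G * Suc B)"
    using t(2) by (simp only: add_mult_distrib)
  moreover have "bounded_mem (w + (1 + k) * G) M'" using t(3) by (rule bounded_mem_mono) simp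
  ultimately show ?case using exec.IteTrue[OF IteTrue.hyps(1) t(1)] by blast
next
  case (IteFalse e M c2 k M' c1)
  have B: "bounded_mem B M" using IteFalse by (auto intro: bounded_mem_mono)
  obtain t where t: "exec \<Omega> c2 M t M'" "t \<le> k * (G * Suc B)" "bounded_mem (w + k * G) M'"
    using IteFalse.IH[of w] IteFalse.prems by (auto simp: add_mult_distrib)
  have "1 + acost e M \<le> (1 + aexp_size e) * Suc B"
    using acost_le[OF B, of e] by (simp add: add_mult_distrib)
  also have "\<dots> \<le> G * Suc B" using IteFalse by (intro mult_right_mono) auto
  finally have "1 + acost e M + t \<le> (1 + k) * (G * Suc B)"
    using t(2) by (simp only: add_mult_distrib)
  moreover have "bounded_mem (w + (1 + k) * G) M'" using t(3) by (rule bounded_mem_mono) simp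
  ultimately show ?case using exec.IteFalse[OF IteFalse.hyps(1) t(1)] by blast
next
  case (WhileTrue e M c k1 M' k2 M'')
  have B: "bounded_mem B M" using WhileTrue by (auto intro: bounded_mem_mono)
  obtain t1 where t1: "exec \<Omega> c M t1 M'" "t1 \<le> k1 * (G * Suc B)" "bounded_mem (w + k1 * G) M'"
    using WhileTrue.IH(1)[of w] WhileTrue.prems by (auto simp: add_mult_distrib)
  obtain t2 where t2: "exec \<Omega> (While e c) M' t2 M''" "t2 \<le> k2 * (G * Suc B)"
    "bounded_mem (w + k1 * G + k2 * G) M''"
    using WhileTrue.IH(2)[OF _ _ t1(3)] WhileTrue.prems by (auto simp: add_mult_distrib)
  have "1 + acost e M \<le> (1 + aexp_size e) * Suc B"
    using acost_le[OF B, of e] by (simp add: add_mult_distrib)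
  also have "\<dots> \<le> G * Suc B" using WhileTrue by (intro mult_right_mono) auto
  finally have "1 + acost e M + t1 + t2 \<le> (1 + k1 + k2) * (G * Suc B)"
    using t1(2) t2(2) by (simp only: add_mult_distrib)
  moreover have "bounded_mem (w + (1 + k1 + k2) * G) M''"
    using t2(3) by (rule bounded_mem_mono) (simp add: add_mult_distrib)
  ultimately show ?case using exec.WhileTrue[OF WhileTrue.hyps(1) t1(1) t2(1)] by blast
next
  case (WhileFalse e M c)
  have B: "bounded_mem B M" using WhileFalse by (auto intro: bounded_mem_mono)
  have "1 + acost e M \<le> (1 + aexp_size e) * Suc B"
    using acost_le[OF B, of e] by (simp add: add_mult_distrib)
  also have "\<dots> \<le> G * Suc B" using WhileFalse by (intro mult_right_mono) auto
  finally have "1 + acost e M \<le> 1 * (G * Suc B)" by simp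
  moreover have "bounded_mem (w + 1 * G) M" using WhileFalse by (auto intro: bounded_mem_mono)
  ultimately show ?case using exec.WhileFalse[OF WhileFalse.hyps(1)] by blast
qed

section \<open>Rules for total correctness with a step budget\<close>

fun modified :: "com \<Rightarrow> nat set" where
  "modified Skip = {}"
| "modified (Store a e1 e2) = {a}"
| "modified (Query a e1 e2) = {a}"
| "modified (Seq c1 c2) = modified c1 \<union> modified c2"
| "modified (Ite e c1 c2) = modified c1 \<union> modified c2"
| "modified (While e c) = modified c"

definition same_off :: "nat set \<Rightarrow> mem \<Rightarrow> mem \<Rightarrow> bool" where
  "same_off A M M' \<longleftrightarrow> (\<forall>a. a \<notin> A \<longrightarrow> M' a = M a)"

lemma same_offD: "same_off A M M' \<Longrightarrow> a \<notin> A \<Longrightarrow> M' a = M a"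
  by (simp add: same_off_def)

lemma same_off_refl: "same_off A M M"
  by (simp add: same_off_def)

lemma same_off_trans: "same_off A M M' \<Longrightarrow> same_off B M' M'' \<Longrightarrow> A \<subseteq> C \<Longrightarrow> B \<subseteq> C \<Longrightarrow> same_off C M M''"
  unfolding same_off_def by (metis subsetD)

lemma run_same_off: "run \<Omega> L c M k M' \<Longrightarrow> same_off (modified c) M M'"
  by (induction rule: run.induct) (auto simp: same_off_def)

text \<open>The budget is only an upper bound, so the two branches of a conditional can share one
  and a loop can charge its worst iteration every time.\<close>

definition wp :: "oracle_fn \<Rightarrow> nat \<Rightarrow> com \<Rightarrow> nat \<Rightarrow> (mem \<Rightarrow> bool) \<Rightarrow> mem \<Rightarrow> bool" where
  "wp \<Omega> L c k Q M \<longleftrightarrow> (\<exists>k' M'. k' \<le> k \<and> run \<Omega> L c M k' M' \<and> Q M')"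

text \<open>Supplies frame information for free: regions that are not syntactic targets of
  \<open>c\<close> keep their contents, and postconditions need not say so.\<close>

lemma wp_conseq:
  assumes "wp \<Omega> L c k Q M" "k \<le> k'" "\<And>M'. same_off (modified c) M M' \<Longrightarrow> Q M' \<Longrightarrow> Q' M'"
  shows "wp \<Omega> L c k' Q' M"
  using assms unfolding wp_def by (meson le_trans run_same_off)

lemma wp_le: "wp \<Omega> L c k Q M \<Longrightarrow> k \<le> k' \<Longrightarrow> wp \<Omega> L c k' Q M"
  by (rule wp_conseq)

lemma wp_Skip: "Q M \<Longrightarrow> wp \<Omega> L Skip 1 Q M"
  unfolding wp_def using run.Skip by blast

lemma wp_Store: "Q (upd M a (aval e1 M) (aval e2 M)) \<Longrightarrow> wp \<Omega> L (Store a e1 e2) 1 Q M"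
  unfolding wp_def using run.Store by blast

lemma wp_Query:
  assumes "\<Omega> (aval e1 M) (aval e2 M) = (p, q)" "bits p \<le> L" "bits q \<le> L"
    "Q (upd (upd M a 0 p) a 1 q)"
  shows "wp \<Omega> L (Query a e1 e2) 1 Q M"
  unfolding wp_def using run.Query[of \<Omega> e1 M e2 p q L a, OF assms(1-3)] assms(4) by blast

lemma wp_Seq: "wp \<Omega> L c1 k1 (wp \<Omega> L c2 k2 Q) M \<Longrightarrow> wp \<Omega> L (Seq c1 c2) (k1 + k2) Q M"
  unfolding wp_def by (meson add_mono run.Seq)

lemma wp_Ite:
  assumes "aval e M \<noteq> 0 \<Longrightarrow> wp \<Omega> L c1 k Q M" "aval e M = 0 \<Longrightarrow> wp \<Omega> L c2 k Q M"
  shows "wp \<Omega> L (Ite e c1 c2) (1 + k) Q M"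
proof (cases "aval e M = 0")
  case True
  with assms(2) show ?thesis unfolding wp_def by (meson add_left_mono run.IteFalse)
next
  case False
  with assms(1) show ?thesis unfolding wp_def by (meson add_left_mono run.IteTrue)
qed

text \<open>The measure \<open>v\<close> bounds the number of iterations. The initial memory stays
  visible in \<open>step\<close> and \<open>exit\<close>, so an invariant has to speak only of
  regions that the body modifies.\<close>

lemma wp_While:
  assumes "I M" "v M \<le> N"
    and step: "\<And>M'. I M' \<Longrightarrow> aval e M' \<noteq> 0 \<Longrightarrow> same_off (modified c) M M' \<Longrightarrow>
      wp \<Omega> L c k (\<lambda>M''. I M'' \<and> v M'' < v M') M'"
    and exit: "\<And>M'. I M' \<Longrightarrow> aval e M' = 0 \<Longrightarrow> same_off (modified c) M M' \<Longrightarrow> Q M'"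
  shows "wp \<Omega> L (While e c) (N * (1 + k) + 1) Q M"
proof -
  have "wp \<Omega> L (While e c) (N * (1 + k) + 1) Q M'"
    if "I M'" "v M' \<le> N" "same_off (modified c) M M'" for M'
    using that
  proof (induction N arbitrary: M')
    case 0
    show ?case
    proof (cases "aval e M' = 0")
      case True
      with exit[OF "0.prems"(1) True "0.prems"(3)] show ?thesis
        unfolding wp_def using run.WhileFalse[OF True] by fastforce
    next
      case False
      from step[OF "0.prems"(1) False "0.prems"(3)] "0.prems"(2) show ?thesis
        unfolding wp_def by auto
    qed
  next
    case (Suc N)
    show ?case
    proof (cases "aval e M' = 0")
      case True
      with exit[OF Suc.prems(1) True Suc.prems(3)] show ?thesis
        unfolding wp_def using run.WhileFalse[OF True] by fastforce
    next
      case False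
      from step[OF Suc.prems(1) False Suc.prems(3)] obtain k1 M'' where
        1: "k1 \<le> k" "run \<Omega> L c M' k1 M''" "I M''" "v M'' < v M'"
        unfolding wp_def by auto
      have "same_off (modified c) M M''"
        using same_off_trans[OF Suc.prems(3) run_same_off[OF 1(2)]] by simp
      with Suc.IH[of M''] 1 Suc.prems obtain k2 M3 where
        2: "k2 \<le> N * (1 + k) + 1" "run \<Omega> L (While e c) M'' k2 M3" "Q M3"
        unfolding wp_def by auto
      have "run \<Omega> L (While e c) M' (1 + k1 + k2) M3"
        using run.WhileTrue[OF False 1(2) 2(2)] .
      moreover have "1 + k1 + k2 \<le> Suc N * (1 + k) + 1" using 1 2 by simp
      ultimately show ?thesis using 2(3) unfolding wp_def by blast
    qed
  qed
  then show ?thesis using assms(1,2) same_off_refl by blast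
qed

abbreviation Var :: "nat \<Rightarrow> aexp" where
  "Var r \<equiv> Load r (Const 0)"

abbreviation Assign :: "nat \<Rightarrow> aexp \<Rightarrow> com" where
  "Assign r e \<equiv> Store r (Const 0) e"

text \<open>The bound is reevaluated in every guard instead of being stored, since it may contain a
  product. The truncated difference is nonzero exactly while the counter is below the bound.\<close>

definition For :: "nat \<Rightarrow> aexp \<Rightarrow> com \<Rightarrow> com" where
  "For r e c = Seq (Assign r (Const 0))
     (While (Sub e (Var r)) (Seq c (Assign r (Add (Var r) (Const 1)))))"

lemma modified_For [simp]: "modified (For r e c) = insert r (modified c)"
  by (auto simp: For_def)

lemma stores_mult_free_For [simp]: "stores_mult_free (For r e c) \<longleftrightarrow> stores_mult_free c"
  by (auto simp: For_def)

lemma wp_For: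
  assumes r: "r \<notin> modified c"
    and e: "\<And>M'. same_off (insert r (modified c)) M M' \<Longrightarrow> aval e M' = N"
    and init: "I 0 (upd M r 0 0)"
    and step: "\<And>z M'. z < N \<Longrightarrow> I z M' \<Longrightarrow> M' r 0 = z \<Longrightarrow> same_off (insert r (modified c)) M M' \<Longrightarrow>
      wp \<Omega> L c k (\<lambda>M''. I (Suc z) (upd M'' r 0 (Suc z))) M'"
    and exit: "\<And>M'. I N M' \<Longrightarrow> M' r 0 = N \<Longrightarrow> same_off (insert r (modified c)) M M' \<Longrightarrow> Q M'"
  shows "wp \<Omega> L (For r e c) (N * (k + 2) + 2) Q M"
proof -
  let ?A = "insert r (modified c)"
  let ?J = "\<lambda>M'. M' r 0 \<le> N \<and> I (M' r 0) M' \<and> same_off ?A M M'"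
  have "wp \<Omega> L (While (Sub e (Var r)) (Seq c (Assign r (Add (Var r) (Const 1)))))
    (N * (1 + (k + 1)) + 1) Q (upd M r 0 0)"
  proof (rule wp_While[where I = ?J and v = "\<lambda>M'. N - M' r 0"])
    show "?J (upd M r 0 0)" using init by (simp add: same_off_def)
    show "N - upd M r 0 0 r 0 \<le> N" by simp
  next
    fix M' assume J: "?J M'" and g: "aval (Sub e (Var r)) M' \<noteq> 0"
    have lt: "M' r 0 < N" using g e[of M'] J by simp
    show "wp \<Omega> L (Seq c (Assign r (Add (Var r) (Const 1)))) (k + 1)
        (\<lambda>M''. ?J M'' \<and> N - M'' r 0 < N - M' r 0) M'"
    proof (rule wp_Seq, rule wp_conseq[OF step[OF lt, of M']], goal_cases)
      case (5 M'')
      have r': "M'' r = M' r" using 5 r by (auto dest: same_offD)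
      have "same_off ?A M M''" using J 5(1) by (blast intro: same_off_trans)
      then have "same_off ?A M (upd M'' r 0 (Suc (M' r 0)))" by (simp add: same_off_def)
      with 5 lt show ?case
        by (intro wp_Store) (auto simp: r')
    qed (use J in auto)
  next
    fix M' assume J: "?J M'" and g: "aval (Sub e (Var r)) M' = 0"
    then have "M' r 0 = N" using e[of M'] by simp
    with J exit show "Q M'" by auto
  qed
  then have "wp \<Omega> L (For r e c) (1 + (N * (1 + (k + 1)) + 1)) Q M"
    unfolding For_def by (intro wp_Seq wp_Store) simp
  then show ?thesis by (simp add: add.commute numeral_2_eq_2)
qed


section \<open>Rounding the costs\<close>

lemma encode_FinE:
  assumes "0 \<le> v"
  obtains p q where "encode (Fin v) = (p, q)" "q > 0" "v = of_nat p / of_nat q"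
proof -
  obtain a b where ab: "quotient_of v = (a, b)" by fastforce
  have b: "b > 0" by (rule quotient_of_denom_pos[OF ab])
  have v: "v = of_int a / of_int b" by (rule quotient_of_div[OF ab])
  with assms b have "a \<ge> 0" by (simp add: zero_le_divide_iff)
  then have "v = of_nat (nat a) / of_nat (nat b)" using b v by simp
  moreover have "encode (Fin v) = (nat a, nat b)" by (simp add: ab)
  ultimately show thesis using b that by simp
qed

text \<open>The value of \<open>x\<close> units of item \<open>i\<close> is at most \<open>j\<close> times the scale \<open>P / R\<close>. The scale with
  \<open>R = 0\<close> is infinite: everything is affordable, also at value infinity and with \<open>j = 0\<close>.\<close>

definition affordable :: "costs \<Rightarrow> nat \<Rightarrow> nat \<Rightarrow> nat \<Rightarrow> nat \<Rightarrow> nat \<Rightarrow> bool" where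
  "affordable f P R i x j \<longleftrightarrow> fst (encode (f i x)) * R \<le> j * P * snd (encode (f i x))"

lemma affordable_Fin:
  assumes "f i x = Fin v" "0 \<le> v"
  shows "affordable f P R i x j \<longleftrightarrow> v * of_nat R \<le> of_nat (j * P)"
proof -
  obtain p q where pq: "encode (Fin v) = (p, q)" "q > 0" "v = of_nat p / of_nat q"
    using assms(2) by (rule encode_FinE)
  have "v * of_nat R \<le> of_nat (j * P) \<longleftrightarrow> (of_nat (p * R) :: rat) \<le> of_nat (j * P * q)"
    using pq(2) unfolding pq(3) by (simp add: field_simps)
  then show ?thesis
    unfolding affordable_def assms(1) pq(1) of_nat_le_iff by simp
qed

lemma affordable_Pinf: "f i x = Pinf \<Longrightarrow> affordable f P R i x j \<longleftrightarrow> R = 0"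
  by (simp add: affordable_def)

definition coverable :: "nat \<Rightarrow> nat \<Rightarrow> nat \<Rightarrow> costs \<Rightarrow> nat \<Rightarrow> nat \<Rightarrow> nat \<Rightarrow> bool" where
  "coverable n m D f K P R \<longleftrightarrow> (\<exists>x\<in>feasible n m D. \<exists>js.
     (\<forall>i<n. affordable f P R i (x i) (js i)) \<and> (\<Sum>i<n. js i) \<le> K)"

lemma feasible_le: "x \<in> feasible n m D \<Longrightarrow> i < n \<Longrightarrow> x i \<le> m"
  by (auto simp: feasible_def PiE_def)

lemma finite_feasible: "finite (feasible n m D)"
  unfolding feasible_def by (rule finite_subset[of _ "{..<n} \<rightarrow>\<^sub>E {..m}"]) (auto intro: finite_PiE)

lemma instance_nonneg: "nlkc_instance n m D f \<Longrightarrow> i < n \<Longrightarrow> x \<le> m \<Longrightarrow> 0 \<le> f i x"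
  by (simp add: nlkc_instance_def)

lemma instance_mono: "nlkc_instance n m D f \<Longrightarrow> i < n \<Longrightarrow> x \<le> y \<Longrightarrow> y \<le> m \<Longrightarrow> f i x \<le> f i y"
  by (auto simp: nlkc_instance_def intro: mono_onD[of "{..m}" "f i"])

lemma instance_value_cases:
  assumes "nlkc_instance n m D f" "i < n" "x \<le> m"
  obtains "f i x = Pinf" | v where "f i x = Fin v" "0 \<le> v"
  using instance_nonneg[OF assms] by (cases "f i x") (auto simp: zero_extended_def)

lemma sum_Fin: "(\<And>i. i \<in> A \<Longrightarrow> g i = Fin (v i)) \<Longrightarrow> sum g A = Fin (sum v A)"
  for g :: "'a \<Rightarrow> 'b::comm_monoid_add extended"
  by (induction A rule: infinite_finite_induct) (auto simp: zero_extended_def)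

lemma sum_eq_Fin_imp:
  fixes g :: "'a \<Rightarrow> 'b::comm_monoid_add extended"
  assumes "sum g A = Fin c" "finite A" "i \<in> A"
  shows "\<exists>v. g i = Fin v"
proof -
  have "g i + sum g (A - {i}) = Fin c"
    using assms by (simp add: sum.remove[symmetric])
  then show ?thesis by (cases "g i"; cases "sum g (A - {i})") auto
qed

lemma sum_extended_nonneg:
  fixes g :: "'a \<Rightarrow> 'b::ordered_comm_monoid_add extended"
  assumes "\<And>i. i \<in> A \<Longrightarrow> 0 \<le> g i"
  shows "0 \<le> sum g A"
  using assms
proof (induction A rule: infinite_finite_induct)
  case (insert i A)
  then have "0 \<le> g i" "0 \<le> sum g A" by auto
  then have "0 \<le> g i + sum g A"
    by (cases "g i"; cases "sum g A") (auto simp: zero_extended_def)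
  then show ?case using insert.hyps by simp
qed auto

lemma cost_cases:
  assumes "nlkc_instance n m D f" "x \<in> feasible n m D"
  obtains "cost n f x = Pinf"
  | v where "\<And>i. i < n \<Longrightarrow> f i (x i) = Fin (v i) \<and> 0 \<le> v i" "cost n f x = Fin (\<Sum>i<n. v i)"
proof (cases "\<forall>i<n. \<exists>v. f i (x i) = Fin v")
  case True
  then obtain v where v: "\<And>i. i < n \<Longrightarrow> f i (x i) = Fin (v i)" by metis
  have "0 \<le> v i" if "i < n" for i
    using instance_nonneg[OF assms(1) that feasible_le[OF assms(2) that]] v[OF that]
    by (simp add: zero_extended_def)
  moreover have "cost n f x = Fin (\<Sum>i<n. v i)"
    unfolding cost_def by (rule sum_Fin) (simp add: v)
  ultimately show thesis using v that(2) by blast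
next
  case False
  then have "cost n f x \<noteq> Fin c" for c
    unfolding cost_def by (auto dest!: sum_eq_Fin_imp)
  moreover have "0 \<le> cost n f x"
    unfolding cost_def by (intro sum_extended_nonneg) (auto intro: instance_nonneg[OF assms(1)] feasible_le[OF assms(2)])
  ultimately show thesis using that(1) by (cases "cost n f x") (auto simp: zero_extended_def)
qed

text \<open>If the optimum is infinite, every feasible vector qualifies. So only competitors with
  all values finite have to be compared.\<close>

lemma approx_solutionI:
  assumes inst: "nlkc_instance n m D f" and x: "x \<in> feasible n m D"
    and le: "\<And>y v. y \<in> feasible n m D \<Longrightarrow> (\<And>i. i < n \<Longrightarrow> f i (y i) = Fin (v i) \<and> 0 \<le> v i) \<Longrightarrow>
      \<exists>c. cost n f x = Fin c \<and> of_rat c \<le> r * of_rat (\<Sum>i<n. v i)"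
  shows "approx_solution r n m D f x"
proof -
  have "opt n m D f \<in> cost n f ` feasible n m D"
    unfolding opt_def using x by (intro Min_in) (auto simp: finite_feasible)
  then obtain y where y: "y \<in> feasible n m D" "opt n m D f = cost n f y" by blast
  from inst y(1) show ?thesis
  proof (cases rule: cost_cases)
    case 1
    then show ?thesis using x y by (simp add: approx_solution_def)
  next
    case (2 v)
    with le[OF y(1), of v] x y show ?thesis by (auto simp: approx_solution_def)
  qed
qed

text \<open>Rounding all values up to multiples of \<open>P / R\<close> costs at most one unit per item.\<close>

lemma not_coverable_imp_cost_ge:
  assumes "\<not> coverable n m D f K P R" "y \<in> feasible n m D" "P > 0"
    and v: "\<And>i. i < n \<Longrightarrow> f i (y i) = Fin (v i) \<and> 0 \<le> v i"
  shows "of_nat K * of_nat P \<le> (\<Sum>i<n. v i) * of_nat R + of_nat n * of_nat P"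
proof -
  define js where "js i = nat \<lceil>v i * of_nat R / of_nat P\<rceil>" for i
  have js: "of_nat (js i) = (of_int \<lceil>v i * of_nat R / of_nat P\<rceil> :: rat)" if "i < n" for i
    using v[OF that] assms(3) unfolding js_def
    by (intro of_nat_nat) (auto intro: order.strict_trans2[of "-1" 0])
  have lo: "v i * of_nat R \<le> of_nat (js i * P)" if "i < n" for i
  proof -
    have "v i * of_nat R / of_nat P \<le> of_nat (js i)"
      unfolding js[OF that] by (rule le_of_int_ceiling)
    then show ?thesis using assms(3) by (simp add: field_simps)
  qed
  have hi: "of_nat (js i) * of_nat P \<le> v i * of_nat R + of_nat P" if "i < n" for i
  proof -
    have "of_nat (js i) \<le> v i * of_nat R / of_nat P + 1"
      unfolding js[OF that] by (rule of_int_ceiling_le_add_one)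
    then show ?thesis using assms(3) by (simp add: field_simps)
  qed
  have "\<forall>i<n. affordable f P R i (y i) (js i)"
    using lo v affordable_Fin by blast
  \<comment> \<open>Otherwise \<open>y\<close> together with these units would witness
    coverability.\<close>
  then have "K < (\<Sum>i<n. js i)"
    using assms(1,2) unfolding coverable_def by (meson not_less)
  then have "of_nat K * of_nat P \<le> (\<Sum>i<n. of_nat (js i) * of_nat P :: rat)"
    by (simp flip: sum_distrib_right of_nat_sum add: mult_right_mono)
  also have "\<dots> \<le> (\<Sum>i<n. v i * of_nat R + of_nat P)"
    by (intro sum_mono) (use hi in auto)
  also have "\<dots> = (\<Sum>i<n. v i) * of_nat R + of_nat n * of_nat P"
    by (simp add: sum.distrib sum_distrib_right)
  finally show ?thesis .
qed

text \<open>A positive \<open>R\<close> makes infinity unaffordable, so all values are finite and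
  the bounds of the single items can be summed.\<close>

lemma affordable_cost_le:
  assumes inst: "nlkc_instance n m D f" and x: "x \<in> feasible n m D"
    and w: "\<And>i. i < n \<Longrightarrow> affordable f P R i (x i) (js i)" and js: "(\<Sum>i<n. js i) \<le> K"
    and R: "R > 0"
  obtains v where "\<And>i. i < n \<Longrightarrow> f i (x i) = Fin (v i) \<and> 0 \<le> v i" "cost n f x = Fin (\<Sum>i<n. v i)"
    "(\<Sum>i<n. v i) * of_nat R \<le> of_nat (K * P)"
  using inst x
proof (cases rule: cost_cases)
  case 1
  have "\<exists>v. f i (x i) = Fin v" if "i < n" for i
    using inst that feasible_le[OF x that]
  proof (cases rule: instance_value_cases)
    case 1
    with w[OF that] R show ?thesis by (simp add: affordable_Pinf)
  qed auto
  then obtain v where "\<And>i. i < n \<Longrightarrow> f i (x i) = Fin (v i)" by metis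
  then have "cost n f x = Fin (\<Sum>i<n. v i)" unfolding cost_def by (intro sum_Fin) auto
  with 1 show ?thesis by simp
next
  case (2 v)
  have "(\<Sum>i<n. v i) * of_nat R = (\<Sum>i<n. v i * of_nat R)" by (simp add: sum_distrib_right)
  also have "\<dots> \<le> (\<Sum>i<n. of_nat (js i * P))"
    by (intro sum_mono) (use w 2(1) affordable_Fin in auto)
  also have "\<dots> = of_nat ((\<Sum>i<n. js i) * P)" by (simp add: sum_distrib_right)
  also have "\<dots> \<le> of_nat (K * P)" unfolding of_nat_le_iff using js by simp
  finally show ?thesis using 2 that by blast
qed

text \<open>The whole budget is worth \<open>K / (Q * (K + 1))\<close>, less than
  \<open>1 / Q\<close>, which bounds every nonzero value from below. So only zero values have been
  bought.\<close>

lemma approx_solution_smallest_scale: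
  assumes inst: "nlkc_instance n m D f" and x: "x \<in> feasible n m D"
    and w: "\<And>i. i < n \<Longrightarrow> affordable f 1 R i (x i) (js i)" and js: "(\<Sum>i<n. js i) \<le> K"
    and R: "R = Q * (K + 1)" "Q > 0"
    and gap: "\<And>i x v. i < n \<Longrightarrow> x \<le> m \<Longrightarrow> f i x = Fin v \<Longrightarrow> v \<noteq> 0 \<Longrightarrow> 1 \<le> v * of_nat Q"
    and r: "0 \<le> r"
  shows "approx_solution r n m D f x"
proof (rule approx_solutionI[OF inst x])
  fix y v assume "y \<in> feasible n m D" and v: "\<And>i. i < n \<Longrightarrow> f i (y i) = Fin (v i) \<and> 0 \<le> v i"
  have "R > 0" using R by simp
  obtain u where u: "\<And>i. i < n \<Longrightarrow> f i (x i) = Fin (u i) \<and> 0 \<le> u i"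
    "cost n f x = Fin (\<Sum>i<n. u i)" "(\<Sum>i<n. u i) * of_nat R \<le> of_nat (K * 1)"
    using affordable_cost_le[OF inst x w js \<open>R > 0\<close>] by blast
  have "u i = 0" if i: "i < n" for i
  proof (rule ccontr)
    assume "u i \<noteq> 0"
    then have 1: "1 \<le> u i * of_nat Q" using gap[OF i feasible_le[OF x i]] u(1)[OF i] by auto
    have "js i \<le> (\<Sum>i<n. js i)" using i by (intro member_le_sum) auto
    then have "js i \<le> K" using js by simp
    then have "(of_nat (js i) :: rat) < of_nat (K + 1)" by (simp only: of_nat_less_iff)
    also have "\<dots> \<le> u i * of_nat Q * of_nat (K + 1)"
      using mult_right_mono[OF 1, of "of_nat (K + 1)"] by simp
    also have "\<dots> = u i * of_nat R" by (simp add: R algebra_simps)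
    also have "\<dots> \<le> of_nat (js i * 1)" using w[OF i] u(1)[OF i] affordable_Fin by blast
    finally show False by simp
  qed
  then have "cost n f x = Fin 0" using u(2) by simp
  moreover have "0 \<le> (\<Sum>i<n. v i)" by (intro sum_nonneg) (use v in auto)
  ultimately show "\<exists>c. cost n f x = Fin c \<and> of_rat c \<le> r * of_rat (\<Sum>i<n. v i)"
    using r by (simp add: zero_le_of_rat_iff)
qed

lemma approx_solution_doubled_scale:
  assumes inst: "nlkc_instance n m D f" and x: "x \<in> feasible n m D"
    and w: "\<And>i. i < n \<Longrightarrow> affordable f (2 * P) R i (x i) (js i)" and js: "(\<Sum>i<n. js i) \<le> k * n"
    and PR: "P > 0" "R > 0" and fail: "\<not> coverable n m D f (k * n) P R"
    and k: "k \<ge> 2" and r: "2 * real k \<le> r * (real k - 1)"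
  shows "approx_solution r n m D f x"
proof (rule approx_solutionI[OF inst x])
  fix y v assume y: "y \<in> feasible n m D" and v: "\<And>i. i < n \<Longrightarrow> f i (y i) = Fin (v i) \<and> 0 \<le> v i"
  let ?v = "\<Sum>i<n. v i"
  obtain u where u: "cost n f x = Fin (\<Sum>i<n. u i)"
    "(\<Sum>i<n. u i) * of_nat R \<le> of_nat (k * n * (2 * P))"
    using inst x w js PR(2) by (rule affordable_cost_le)
  let ?u = "\<Sum>i<n. u i"
  have "of_nat (k * n) * of_nat P \<le> ?v * of_nat R + of_nat n * of_nat P"
    using fail y PR(1) v by (rule not_coverable_imp_cost_ge)
  then have "real_of_rat (of_nat (k * n) * of_nat P) \<le> of_rat (?v * of_nat R + of_nat n * of_nat P)"
    by (simp only: of_rat_less_eq)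
  then have low: "(real k - 1) * (real n * real P) \<le> of_rat ?v * real R"
    by (simp add: of_rat_add of_rat_mult algebra_simps del: of_rat_sum)
  have "real_of_rat (?u * of_nat R) \<le> of_rat (of_nat (k * n * (2 * P)))"
    using u(2) by (simp only: of_rat_less_eq)
  then have "of_rat ?u * real R \<le> 2 * real k * (real n * real P)"
    by (simp add: of_rat_mult algebra_simps)
  also have "\<dots> \<le> r * (real k - 1) * (real n * real P)"
    by (rule mult_right_mono[OF r]) simp
  also have "\<dots> = r * ((real k - 1) * (real n * real P))" by simp
  also have "\<dots> \<le> r * (of_rat ?v * real R)"
  proof (rule mult_left_mono[OF low])
    \<comment> \<open>Multiplying the lower bound by \<open>r\<close> needs its sign, which follows
      from the hypothesis on \<open>r\<close> because \<open>k\<close> exceeds 1.\<close>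
    have "0 \<le> r * (real k - 1)" using r by (rule order_trans[rotated]) simp
    then show "0 \<le> r" using k by (simp add: zero_le_mult_iff)
  qed
  finally have "of_rat ?u \<le> r * of_rat ?v" using PR by simp
  with u(1) show "\<exists>c. cost n f x = Fin c \<and> of_rat c \<le> r * of_rat ?v" by blast
qed

text \<open>The scale exceeds every finite value, so one unit per item pays for any solution of
  finite cost, and these \<open>n\<close> units fit into the budget. The failure therefore shows
  that no such solution exists.\<close>

lemma approx_solution_infinite:
  assumes inst: "nlkc_instance n m D f" and x: "x \<in> feasible n m D"
    and fail: "\<not> coverable n m D f (k * n) P R" and P: "U * R < P" and k: "k \<ge> 1"
    and U: "\<And>i x v. i < n \<Longrightarrow> x \<le> m \<Longrightarrow> f i x = Fin v \<Longrightarrow> v \<le> of_nat U"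
  shows "approx_solution r n m D f x"
proof (rule approx_solutionI[OF inst x])
  fix y v assume y: "y \<in> feasible n m D" and v: "\<And>i. i < n \<Longrightarrow> f i (y i) = Fin (v i) \<and> 0 \<le> v i"
  have "affordable f P R i (y i) 1" if i: "i < n" for i
  proof -
    have "v i * of_nat R \<le> of_nat U * of_nat R"
      using U[OF i feasible_le[OF y i]] v[OF i] by (intro mult_right_mono) auto
    also have "\<dots> = of_nat (U * R)" by simp
    also have "\<dots> \<le> of_nat (1 * P)" unfolding of_nat_le_iff using P by simp
    finally show ?thesis using v[OF i] affordable_Fin by blast
  qed
  then have "coverable n m D f (k * n) P R"
    unfolding coverable_def using y k by (intro bexI[of _ y] exI[of _ "\<lambda>_. 1"]) auto
  with fail show "\<exists>c. cost n f x = Fin c \<and> of_rat c \<le> r * of_rat (\<Sum>i<n. v i)" by simp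
qed

text \<open>Guarantees that the attempt at the infinite scale succeeds: zero units buy any feasible
  vector.\<close>

lemma coverable_unbounded:
  assumes "nlkc_instance n m D f"
  shows "coverable n m D f K P 0"
proof -
  obtain x where "x \<in> feasible n m D" using assms by (auto simp: nlkc_instance_def)
  then show ?thesis unfolding coverable_def affordable_def by (intro bexI[of _ x] exI[of _ "\<lambda>_. 0"]) auto
qed


section \<open>Binary search and dynamic programming\<close>

text \<open>The scale that is being tried is the quotient of \<open>num_reg\<close> by \<open>K + 1\<close> times \<open>den_reg\<close>. The
  factor \<open>K + 1\<close> is recomputed in expressions because products must not be stored.\<close>

abbreviation (input) "item_reg \<equiv> 2 :: nat"
abbreviation (input) "units_reg \<equiv> 3 :: nat"
abbreviation (input) "budget_reg \<equiv> 4 :: nat"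
abbreviation (input) "low_reg \<equiv> 5 :: nat"
abbreviation (input) "high_reg \<equiv> 6 :: nat"
abbreviation (input) "mid_reg \<equiv> 7 :: nat"
abbreviation (input) "answer_reg \<equiv> 8 :: nat"
abbreviation (input) "den_reg \<equiv> 9 :: nat"
abbreviation (input) "top_reg \<equiv> 10 :: nat"
abbreviation (input) "num_reg \<equiv> 11 :: nat"
abbreviation (input) "continue_reg \<equiv> 12 :: nat"
abbreviation (input) "table_reg \<equiv> 13 :: nat"
abbreviation (input) "units_choice_reg \<equiv> 14 :: nat"
abbreviation (input) "amount_choice_reg \<equiv> 15 :: nat"

abbreviation (input) "n_exp \<equiv> Load 0 (Const 0)"
abbreviation (input) "m_exp \<equiv> Load 0 (Const 1)"
abbreviation (input) "D_exp \<equiv> Load 0 (Const 2)"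

text \<open>Leaves the number of amounts whose value \<open>p / q\<close> satisfies \<open>A * p + B \<le> C * q\<close> in \<open>low_reg\<close>;
  the largest such amount is one less.\<close>

definition search :: "aexp \<Rightarrow> aexp \<Rightarrow> aexp \<Rightarrow> com" where
  "search A B C =
     Seq (Assign low_reg (Const 0))
    (Seq (Assign high_reg (Add m_exp (Const 1)))
    (While (Sub (Var high_reg) (Var low_reg))
      (Seq (Assign mid_reg (Div (Add (Var low_reg) (Var high_reg)) (Const 2)))
      (Seq (Query answer_reg (Var item_reg) (Var mid_reg))
      (Ite (Sub (Add (Mul C (Load answer_reg (Const 1))) (Const 1))
                (Add (Mul A (Load answer_reg (Const 0))) B))
        (Assign low_reg (Add (Var mid_reg) (Const 1)))
        (Assign high_reg (Var mid_reg)))))))"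

lemma modified_search [simp]: "modified (search A B C) = {low_reg, high_reg, mid_reg, answer_reg}"
  by (auto simp: search_def)

lemma stores_mult_free_search [simp]: "stores_mult_free (search A B C)"
  by (simp add: search_def)

text \<open>Polymorphic so that the same expression can be read as a number and as a polynomial. Its
  unsimplified shape mirrors the budgets produced by the \<open>wp\<close> rules; the other step
  counts follow the same pattern.\<close>

definition search_steps :: "'a::comm_semiring_1 \<Rightarrow> 'a" where
  "search_steps b = 1 + (1 + (b * (1 + (1 + (1 + (1 + 1)))) + 1))"

text \<open>The threshold of the downward closed predicate lies between the two bounds; amounts from
  \<open>low_reg\<close> up to but excluding \<open>high_reg\<close> are undecided. Starting at
  \<open>m + 1\<close> covers the case that every amount qualifies.\<close>

lemma wp_search:
  fixes i m a b c :: nat and \<Omega> :: oracle_fn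
  defines "pr \<equiv> \<lambda>x. a * fst (\<Omega> i x) + b \<le> c * snd (\<Omega> i x)"
  assumes answers: "\<And>x. x \<le> m \<Longrightarrow> bits (fst (\<Omega> i x)) \<le> L \<and> bits (snd (\<Omega> i x)) \<le> L"
    and M: "M 0 1 = m" "M item_reg 0 = i"
    and vals: "\<And>M'. same_off {low_reg, high_reg, mid_reg, answer_reg} M M' \<Longrightarrow>
      aval A M' = a \<and> aval B M' = b \<and> aval C M' = c"
    and down: "\<And>x y. x \<le> y \<Longrightarrow> y \<le> m \<Longrightarrow> pr y \<Longrightarrow> pr x"
    and post: "\<And>M'. same_off {low_reg, high_reg, mid_reg, answer_reg} M M' \<Longrightarrow>
      M' low_reg 0 \<le> Suc m \<Longrightarrow> \<forall>x\<le>m. pr x \<longleftrightarrow> x < M' low_reg 0 \<Longrightarrow> Q M'"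
  shows "wp \<Omega> L (search A B C) (search_steps (bits (Suc m))) Q M"
proof -
  let ?S = "same_off {low_reg, high_reg, mid_reg, answer_reg} M"
  let ?I = "\<lambda>M'. ?S M' \<and> M' low_reg 0 \<le> M' high_reg 0 \<and> M' high_reg 0 \<le> Suc m \<and>
    (\<forall>x < M' low_reg 0. pr x) \<and> (\<forall>x. M' high_reg 0 \<le> x \<longrightarrow> x \<le> m \<longrightarrow> \<not> pr x)"
  \<comment> \<open>Halving the undecided interval removes a binary digit of its length.\<close>
  let ?v = "\<lambda>M'. bits (M' high_reg 0 - M' low_reg 0)"
  show ?thesis
    unfolding search_def search_steps_def
  proof (intro wp_Seq wp_Store, rule wp_While[where I = ?I and v = ?v], goal_cases)
    case 1
    show ?case using M by (auto simp: same_off_def)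
  next
    case 2
    show ?case using M by simp
  next
    case (3 M')
    define lo hi where "lo = M' low_reg 0" and "hi = M' high_reg 0"
    define mid where "mid = (lo + hi) div 2"
    have S: "?S M'" and lt: "lo < hi" and hi: "hi \<le> Suc m"
      using 3 by (auto simp: lo_def hi_def)
    \<comment> \<open>The query stays inside the domain of the costs, where the answer is meaningful
      and short.\<close>
    have mid: "lo \<le> mid" "mid < hi" "mid \<le> m" using lt hi by (auto simp: mid_def)
    have item: "M' item_reg 0 = i" using S M by (simp add: same_off_def)
    have bits_lt: "bits d < bits (hi - lo)" if "d \<le> (hi - lo) div 2" for d
    proof -
      have "bits d \<le> bits ((hi - lo) div 2)" using that by (rule bits_mono)
      also have "\<dots> < bits (hi - lo)" using lt by (subst (2) compute_floorlog) simp
      finally show ?thesis .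
    qed
    obtain p q where pq: "\<Omega> i mid = (p, q)" by fastforce
    \<comment> \<open>The guard is a truncated difference, so it tests a strict inequality; adding 1
      on the right turns it into the required weak one.\<close>
    have pr_mid: "pr mid \<longleftrightarrow> a * p + b < c * q + 1" by (auto simp: pr_def pq)
    show ?case
    proof (intro wp_Seq wp_Store, rule wp_Query[where p = p and q = q])
      show "\<Omega> (aval (Var item_reg) (upd M' mid_reg (aval (Const 0) M')
            (aval (Div (Add (Var low_reg) (Var high_reg)) (Const 2)) M')))
          (aval (Var mid_reg) (upd M' mid_reg (aval (Const 0) M')
            (aval (Div (Add (Var low_reg) (Var high_reg)) (Const 2)) M'))) = (p, q)"
        using pq item by (simp add: lo_def hi_def mid_def)
      show "bits p \<le> L" "bits q \<le> L" using answers[OF mid(3)] pq by auto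
      let ?M = "upd (upd (upd M' mid_reg (aval (Const 0) M')
            (aval (Div (Add (Var low_reg) (Var high_reg)) (Const 2)) M')) answer_reg 0 p) answer_reg 1 q"
      have S': "?S ?M" using S by (simp add: same_off_def)
      have M'': "?M mid_reg 0 = mid" "?M low_reg = M' low_reg" "?M high_reg = M' high_reg"
        "?M answer_reg 0 = p" "?M answer_reg 1 = q"
        by (simp_all add: lo_def hi_def mid_def)
      show "wp \<Omega> L (Ite (Sub (Add (Mul C (Load answer_reg (Const 1))) (Const 1))
                (Add (Mul A (Load answer_reg (Const 0))) B))
        (Assign low_reg (Add (Var mid_reg) (Const 1)))
        (Assign high_reg (Var mid_reg))) (1 + 1) (\<lambda>M''. ?I M'' \<and> ?v M'' < ?v M') ?M"
      proof (rule wp_Ite)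
        assume "aval (Sub (Add (Mul C (Load answer_reg (Const 1))) (Const 1))
                (Add (Mul A (Load answer_reg (Const 0))) B)) ?M \<noteq> 0"
        then have "pr mid" using vals[OF S'] by (simp add: M'' pr_mid)
        then have "\<forall>x<Suc mid. pr x" using down mid by (auto simp: less_Suc_eq_le)
        moreover have "bits (hi - Suc mid) < bits (hi - lo)" by (rule bits_lt) (simp add: mid_def)
        ultimately show "wp \<Omega> L (Assign low_reg (Add (Var mid_reg) (Const 1))) 1
            (\<lambda>M''. ?I M'' \<and> ?v M'' < ?v M') ?M"
          using 3 S' mid by (intro wp_Store) (auto simp: same_off_def lo_def hi_def mid_def)
      next
        assume "aval (Sub (Add (Mul C (Load answer_reg (Const 1))) (Const 1))
                (Add (Mul A (Load answer_reg (Const 0))) B)) ?M = 0"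
        then have "\<not> pr mid" using vals[OF S'] by (simp add: M'' pr_mid)
        then have "\<forall>x. mid \<le> x \<longrightarrow> x \<le> m \<longrightarrow> \<not> pr x" using down by blast
        moreover have "bits (mid - lo) < bits (hi - lo)" by (rule bits_lt) (use lt in \<open>simp add: mid_def\<close>)
        ultimately show "wp \<Omega> L (Assign high_reg (Var mid_reg)) 1
            (\<lambda>M''. ?I M'' \<and> ?v M'' < ?v M') ?M"
          using 3 S' mid by (intro wp_Store) (auto simp: same_off_def lo_def hi_def mid_def)
      qed
    qed
  next
    case (4 M')
    then have "M' low_reg 0 = M' high_reg 0" by simp
    with 4 show ?case by (intro post) (auto simp: not_less[symmetric])
  qed
qed

section \<open>The dynamic programming table\<close>

definition cell :: "nat \<Rightarrow> nat \<Rightarrow> nat \<Rightarrow> nat" where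
  "cell K i c = i * (K + 1) + c"

lemma cell_eq_iff:
  assumes "c \<le> K" "c' \<le> K"
  shows "cell K i c = cell K i' c' \<longleftrightarrow> i = i' \<and> c = c'"
proof
  assume eq: "cell K i c = cell K i' c'"
  have "cell K i c div (K + 1) = i" "cell K i' c' div (K + 1) = i'"
    using assms by (simp_all only: cell_def div_mult_self3) simp_all
  with eq have "i = i'" by simp
  with eq show "i = i' \<and> c = c'" by (simp add: cell_def)
qed simp

definition budget_exp :: "nat \<Rightarrow> aexp" where
  "budget_exp k = Mul (Const k) n_exp"

abbreviation "width_exp k \<equiv> Add (budget_exp k) (Const 1)"

definition cell_exp :: "nat \<Rightarrow> aexp \<Rightarrow> aexp \<Rightarrow> aexp" where
  "cell_exp k e1 e2 = Add (Mul e1 (width_exp k)) e2"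

lemma aval_budget_exp [simp]: "aval (budget_exp k) M = k * M 0 0"
  by (simp add: budget_exp_def)

lemma aval_cell_exp [simp]: "aval (cell_exp k e1 e2) M = cell (k * M 0 0) (aval e1 M) (aval e2 M)"
  by (simp add: cell_exp_def cell_def)

text \<open>The product in the guard is a conjunction: the source is reachable, some amount is
  affordable, and the new total improves the target. Source entry and \<open>low_reg\<close> each
  exceed an amount by one, so their sum is one too large for an entry.\<close>

definition relax :: "nat \<Rightarrow> com" where
  "relax k = (let source = Load table_reg (cell_exp k (Var item_reg) (Var budget_reg));
       target = cell_exp k (Add (Var item_reg) (Const 1)) (Add (Var budget_reg) (Var units_reg)) in
     Ite (Mul (Mul source (Var low_reg))
           (Sub (Add source (Var low_reg)) (Add (Load table_reg target) (Const 1))))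
      (Seq (Store table_reg target (Sub (Add source (Var low_reg)) (Const 1)))
      (Seq (Store units_choice_reg target (Var units_reg))
        (Store amount_choice_reg target (Sub (Var low_reg) (Const 1)))))
      Skip)"

text \<open>The row is cleared because it may hold entries of an earlier scale. The units form the
  outer loop so that one binary search serves all budgets.\<close>

definition fill_row :: "nat \<Rightarrow> com" where
  "fill_row k =
     Seq (For budget_reg (width_exp k)
       (Store table_reg (cell_exp k (Add (Var item_reg) (Const 1)) (Var budget_reg)) (Const 0)))
     (For units_reg (width_exp k)
       (Seq (search (Mul (Var den_reg) (width_exp k)) (Const 0) (Mul (Var units_reg) (Var num_reg)))
         (For budget_reg (Sub (width_exp k) (Var units_reg)) (relax k))))"

definition fill_table :: "nat \<Rightarrow> com" where
  "fill_table k =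
     Seq (For budget_reg (width_exp k) (Store table_reg (cell_exp k (Const 0) (Var budget_reg)) (Const 1)))
     (For item_reg n_exp (fill_row k))"

lemma modified_relax [simp]: "modified (relax k) = {table_reg, units_choice_reg, amount_choice_reg}"
  by (auto simp: relax_def Let_def)

lemma modified_fill_row [simp]: "modified (fill_row k) =
    {units_reg, budget_reg, low_reg, high_reg, mid_reg, answer_reg, table_reg, units_choice_reg, amount_choice_reg}"
  by (auto simp: fill_row_def)

lemma modified_fill_table [simp]: "modified (fill_table k) =
    {item_reg, units_reg, budget_reg, low_reg, high_reg, mid_reg, answer_reg, table_reg, units_choice_reg, amount_choice_reg}"
  by (auto simp: fill_table_def)

lemma stores_mult_free_fill_table [simp]: "stores_mult_free (fill_table k)"
  by (simp add: fill_table_def fill_row_def relax_def Let_def)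

text \<open>What tracing back needs: the recorded choice acts as a back pointer that explains a
  nonzero entry exactly.\<close>

definition entry_sound :: "costs \<Rightarrow> nat \<Rightarrow> nat \<Rightarrow> nat \<Rightarrow> nat \<Rightarrow> mem \<Rightarrow> nat \<Rightarrow> nat \<Rightarrow> bool" where
  "entry_sound f m K P R M i c \<longleftrightarrow>
     (let w = M table_reg (cell K (Suc i) c); j = M units_choice_reg (cell K (Suc i) c);
        x = M amount_choice_reg (cell K (Suc i) c); u = M table_reg (cell K i (c - j)) in
      0 < w \<longrightarrow> j \<le> c \<and> x \<le> m \<and> affordable f P R i x j \<and> 0 < u \<and> w = u + x)"

text \<open>The bound \<open>J\<close> describes partially filled rows, in which only choices of
  fewer than \<open>J\<close> units have been tried.\<close>

definition entry_complete :: "costs \<Rightarrow> nat \<Rightarrow> nat \<Rightarrow> nat \<Rightarrow> nat \<Rightarrow> mem \<Rightarrow> nat \<Rightarrow> nat \<Rightarrow> nat \<Rightarrow> bool" where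
  "entry_complete f m K P R M J i c \<longleftrightarrow>
     (\<forall>j x. j < J \<longrightarrow> j \<le> c \<longrightarrow> x \<le> m \<longrightarrow> affordable f P R i x j \<longrightarrow> 0 < M table_reg (cell K i (c - j)) \<longrightarrow>
        M table_reg (cell K i (c - j)) + x \<le> M table_reg (cell K (Suc i) c))"

text \<open>Entries of the table are one more than the largest amount that the first \<open>i\<close> items can
  provide within the budget \<open>c\<close>, and zero if these items cannot be paid for at all.\<close>

definition table_correct :: "costs \<Rightarrow> nat \<Rightarrow> nat \<Rightarrow> nat \<Rightarrow> nat \<Rightarrow> mem \<Rightarrow> nat \<Rightarrow> bool" where
  "table_correct f m K P R M i \<longleftrightarrow> (\<forall>c\<le>K. M table_reg (cell K 0 c) = 1) \<and>
     (\<forall>i'<i. \<forall>c\<le>K. entry_sound f m K P R M i' c \<and> entry_complete f m K P R M (Suc K) i' c)"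

lemma table_correct_cong:
  assumes "\<And>a i' c. a \<in> {table_reg, units_choice_reg, amount_choice_reg} \<Longrightarrow> i' \<le> i \<Longrightarrow> c \<le> K \<Longrightarrow>
    M' a (cell K i' c) = M a (cell K i' c)"
  shows "table_correct f m K P R M' i \<longleftrightarrow> table_correct f m K P R M i"
  unfolding table_correct_def entry_sound_def entry_complete_def Let_def
  by (simp add: assms cong: conj_cong imp_cong)

lemma table_correct_upd [simp]:
  "a \<notin> {table_reg, units_choice_reg, amount_choice_reg} \<Longrightarrow>
   table_correct f m K P R (upd M a l v) i \<longleftrightarrow> table_correct f m K P R M i"
  by (rule table_correct_cong) auto

lemma entry_sound_upd [simp]:
  "a \<notin> {table_reg, units_choice_reg, amount_choice_reg} \<Longrightarrow>
   entry_sound f m K P R (upd M a l v) i c \<longleftrightarrow> entry_sound f m K P R M i c"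
  by (auto simp: entry_sound_def Let_def)

lemma entry_complete_upd [simp]:
  "a \<noteq> table_reg \<Longrightarrow>
   entry_complete f m K P R (upd M a l v) J i c \<longleftrightarrow> entry_complete f m K P R M J i c"
  by (auto simp: entry_complete_def)

lemma table_correct_upd_row:
  "i < i' \<Longrightarrow> c \<le> K \<Longrightarrow>
   table_correct f m K P R (upd M table_reg (cell K i' c) v) i \<longleftrightarrow> table_correct f m K P R M i"
  by (rule table_correct_cong) (auto simp: cell_eq_iff)

text \<open>The state after pushing \<open>j\<close> units from the first \<open>z\<close> budgets,
  which serves the columns from \<open>j\<close> up to \<open>j + z - 1\<close>. Columns below
  \<open>j\<close> count as finished from the start, since \<open>j\<close> units exceed their
  budget.\<close>

definition relax_inv :: "costs \<Rightarrow> nat \<Rightarrow> nat \<Rightarrow> nat \<Rightarrow> nat \<Rightarrow> nat \<Rightarrow> nat \<Rightarrow> nat \<Rightarrow> mem \<Rightarrow> bool" where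
  "relax_inv f m K P R i j z M \<longleftrightarrow> table_correct f m K P R M i \<and>
     (\<forall>c\<le>K. entry_sound f m K P R M i c \<and>
        entry_complete f m K P R M (if c < j + z then Suc j else j) i c)"

lemma wp_relax:
  assumes M: "k * M 0 0 = K" "M item_reg 0 = i" "M units_reg 0 = j" "M budget_reg 0 = z"
    and z: "z + j \<le> K"
    and low: "M low_reg 0 \<le> Suc m" "\<forall>x\<le>m. affordable f P R i x j \<longleftrightarrow> x < M low_reg 0"
    and inv: "relax_inv f m K P R i j z M"
    and post: "\<And>M'. same_off {table_reg, units_choice_reg, amount_choice_reg} M M' \<Longrightarrow>
      relax_inv f m K P R i j (Suc z) M' \<Longrightarrow> Q M'"
  shows "wp \<Omega> L (relax k) (1 + (1 + (1 + 1))) Q M"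
proof -
  define lo u w where "lo = M low_reg 0" and "u = M table_reg (cell K i z)"
    and "w = M table_reg (cell K (Suc i) (z + j))"
  have inv': "table_correct f m K P R M i"
    "\<And>c. c \<le> K \<Longrightarrow> entry_sound f m K P R M i c"
    "\<And>c. c \<le> K \<Longrightarrow> entry_complete f m K P R M (if c < j + z then Suc j else j) i c"
    using inv by (auto simp: relax_inv_def)
  note M' = M M(1)[unfolded mult.commute[of k]]
  show ?thesis
    unfolding relax_def Let_def
  proof (rule wp_Ite, goal_cases)
    case 1
    then have g: "0 < u" "0 < lo" "w + 1 < u + lo"
      by (auto simp: M' u_def lo_def w_def)
    let ?t = "cell K (Suc i) (z + j)"
    define N where "N = upd (upd (upd M table_reg ?t (u + lo - 1)) units_choice_reg ?t j) amount_choice_reg ?t (lo - 1)"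
    \<comment> \<open>All writes go to the next row, so the sources stay intact.\<close>
    have row: "N a (cell K i' c) = M a (cell K i' c)" if "i' \<le> i" "c \<le> K" for a i' c
      using that z by (simp add: N_def cell_eq_iff)
    have row': "N table_reg (cell K (Suc i) c) = (if c = z + j then u + lo - 1 else M table_reg (cell K (Suc i) c))"
      "N units_choice_reg (cell K (Suc i) c) = (if c = z + j then j else M units_choice_reg (cell K (Suc i) c))"
      "N amount_choice_reg (cell K (Suc i) c) = (if c = z + j then lo - 1 else M amount_choice_reg (cell K (Suc i) c))"
      if "c \<le> K" for c
      using that z by (simp_all add: N_def cell_eq_iff)
    have Nu: "N table_reg (cell K i z) = u"
      using row[of i z table_reg] z by (simp add: u_def)
    have "table_correct f m K P R N i"
      using inv'(1) row by (subst table_correct_cong[of _ _ _ M]) auto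
    moreover have "entry_sound f m K P R N i c" if "c \<le> K" for c
    proof (cases "c = z + j")
      case True
      then show ?thesis
        using that g low z
        by (simp add: entry_sound_def row' Nu Let_def) (auto simp: lo_def)
    next
      case False
      then show ?thesis
        using that inv'(2)[OF that] by (simp add: entry_sound_def row' row Let_def)
    qed
    moreover have "entry_complete f m K P R N (if c < j + Suc z then Suc j else j) i c" if "c \<le> K" for c
    proof (cases "c = z + j")
      case True
      have "M table_reg (cell K i (c - j')) + x \<le> u + lo - 1"
        if "j' < Suc j" "x \<le> m" "affordable f P R i x j'" "0 < M table_reg (cell K i (c - j'))" for j' x
      proof (cases "j' = j")
        case eq: True
        then have "x < lo" using low(2) that(2,3) by (simp add: lo_def)
        then show ?thesis using True eq by (simp add: u_def)
      next
        case False
        then have "j' < j" "j' \<le> c" using that(1) True by auto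
        with inv'(3)[OF \<open>c \<le> K\<close>] that(2-4) True
        have "M table_reg (cell K i (c - j')) + x \<le> w"
          unfolding entry_complete_def w_def by auto
        then show ?thesis using g(3) by simp
      qed
      then show ?thesis
        using True \<open>c \<le> K\<close> by (simp add: entry_complete_def row' row)
    next
      case False
      then have "(if c < j + Suc z then Suc j else j) = (if c < j + z then Suc j else j)" by auto
      then show ?thesis
        using False that inv'(3)[OF that] by (simp add: entry_complete_def row' row)
    qed
    ultimately have "relax_inv f m K P R i j (Suc z) N" by (simp add: relax_inv_def)
    then have "Q N" by (intro post) (simp_all add: same_off_def N_def)
    then show ?case
      by (intro wp_Seq wp_Store) (simp add: N_def M' u_def lo_def)
  next
    case 2
    \<comment> \<open>A vanishing product means that one of the three conditions fails; in each case
      the target already dominates this choice.\<close>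
    then have g: "u = 0 \<or> lo = 0 \<or> u + lo \<le> w + 1"
      by (auto simp: M' u_def lo_def w_def)
    have "entry_complete f m K P R M (if c < j + Suc z then Suc j else j) i c" if "c \<le> K" for c
    proof (cases "c = z + j")
      case True
      have "M table_reg (cell K i (c - j')) + x \<le> w"
        if "j' < Suc j" "x \<le> m" "affordable f P R i x j'" "0 < M table_reg (cell K i (c - j'))" for j' x
      proof (cases "j' = j")
        case eq: True
        then have "x < lo" using low(2) that(2,3) by (simp add: lo_def)
        then show ?thesis using True eq g that(4) by (auto simp: u_def)
      next
        case False
        then have "j' < j" "j' \<le> c" using that(1) True by auto
        with inv'(3)[OF \<open>c \<le> K\<close>] that(2-4) True
        show ?thesis
          unfolding entry_complete_def w_def by auto
      qed
      then show ?thesis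
        using True by (simp add: entry_complete_def w_def)
    next
      case False
      then have "(if c < j + Suc z then Suc j else j) = (if c < j + z then Suc j else j)" by auto
      then show ?thesis
        using inv'(3)[OF that] by simp
    qed
    then have "relax_inv f m K P R i j (Suc z) M" using inv' by (simp add: relax_inv_def)
    then have "Q M" by (intro post) (simp_all add: same_off_def)
    then show ?case by (intro wp_le[OF wp_Skip]) simp_all
  qed
qed

definition row_steps :: "'a::comm_semiring_1 \<Rightarrow> 'a \<Rightarrow> 'a" where
  "row_steps w b = (w * (1 + 2) + 2) +
     (w * ((search_steps b + (w * ((1 + (1 + (1 + 1))) + 2) + 2)) + 2) + 2)"

locale knapsack_cover =
  fixes n m D :: nat and f :: costs and k :: nat
  assumes inst: "nlkc_instance n m D f"
begin

abbreviation "K \<equiv> k * n"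
abbreviation "L \<equiv> max_value_bits n m f"
abbreviation "prog_wp \<equiv> wp (cost_oracle f) L"

lemma answer_bits:
  assumes "i < n" "x \<le> m"
  shows "bits (fst (cost_oracle f i x)) \<le> L \<and> bits (snd (cost_oracle f i x)) \<le> L"
proof -
  have "finite {value_bits (f i x) | i x. i < n \<and> x \<le> m}"
    by (rule finite_subset[of _ "(\<lambda>(i, x). value_bits (f i x)) ` ({..<n} \<times> {..m})"]) auto
  then have "value_bits (f i x) \<le> L"
    unfolding max_value_bits_def using assms by (intro Max_ge) auto
  then show ?thesis by (simp add: value_bits_def cost_oracle_def)
qed

text \<open>Makes binary search applicable. An affordable infinite value forces
  \<open>R = 0\<close>, where every amount is affordable.\<close>

lemma affordable_antimono:
  assumes "i < n" "x \<le> y" "y \<le> m" "affordable f P R i y j"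
  shows "affordable f P R i x j"
proof -
  have le: "f i x \<le> f i y" using instance_mono[OF inst assms(1-3)] .
  have "x \<le> m" using assms by simp
  with inst assms(1) show ?thesis
  proof (cases rule: instance_value_cases)
    case 1
    with le assms(4) show ?thesis by (simp add: affordable_Pinf)
  next
    case x: (2 u)
    from inst assms(1,3) show ?thesis
    proof (cases rule: instance_value_cases)
      case 1
      with assms(4) x show ?thesis by (simp add: affordable_Pinf affordable_Fin)
    next
      case (2 v)
      have "u * of_nat R \<le> v * of_nat R" using le x 2 by (intro mult_right_mono) auto
      with x 2 assms(4) show ?thesis by (simp add: affordable_Fin)
    qed
  qed
qed

lemma wp_fill_row:
  assumes M: "M 0 0 = n" "M 0 1 = m" "M item_reg 0 = i" "M num_reg 0 = P" "M den_reg 0 * (K + 1) = R"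
    and i: "i < n" and tc: "table_correct f m K P R M i"
    and post: "\<And>M'. same_off (modified (fill_row k)) M M' \<Longrightarrow> table_correct f m K P R M' (Suc i) \<Longrightarrow> Q M'"
  shows "prog_wp (fill_row k) (row_steps (K + 1) (bits (Suc m))) Q M"
  unfolding fill_row_def row_steps_def
proof (rule wp_Seq, rule wp_For[where I = "\<lambda>z M'. table_correct f m K P R M' i \<and>
      (\<forall>c<z. M' table_reg (cell K (Suc i) c) = 0)"], goal_cases)
  case 1
  then show ?case by simp
next
  case (2 M')
  then show ?case by (simp add: same_off_def M)
next
  case 3
  then show ?case using tc by simp
next
  case (4 z M')
  have M': "M' 0 0 = n" "M' item_reg 0 = i" using 4 M by (auto simp: same_off_def)
  show ?case
    using 4 by (intro wp_Store) (auto simp del: upd_apply simp: upd_apply[where b = table_reg] M' cell_eq_iff less_Suc_eq table_correct_upd_row)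
next
  case (5 M1)
  have M1: "M1 0 0 = n" "M1 0 (Suc 0) = m" "M1 item_reg 0 = i" "M1 num_reg 0 = P" "M1 den_reg 0 * (K + 1) = R"
    using 5(3) M by (auto simp: same_off_def)
  have S1: "same_off (modified (fill_row k)) M M1" using 5(3) by (simp add: same_off_def)
  show ?case
  proof (rule wp_For[where I = "\<lambda>z M'. table_correct f m K P R M' i \<and>
      (\<forall>c\<le>K. entry_sound f m K P R M' i c \<and> entry_complete f m K P R M' z i c)"], goal_cases)
    case 1
    then show ?case by simp
  next
    case (2 M')
    then show ?case by (simp add: same_off_def M1)
  next
    \<comment> \<open>A cleared row is vacuously sound, and vacuously complete as long as no number
      of units has been tried.\<close>
    case 3
    then show ?case
      using 5(1) by (auto simp: entry_sound_def entry_complete_def)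
  next
    case (4 j M2)
    have M2: "M2 0 0 = n" "M2 0 (Suc 0) = m" "M2 item_reg 0 = i" "M2 num_reg 0 = P" "M2 den_reg 0 * (K + 1) = R"
      "M2 units_reg 0 = j"
      using 4(3,4) M1 by (auto simp: same_off_def)
    show ?case
    proof (rule wp_Seq, rule wp_search[where m = m and i = i and a = R and b = 0 and c = "j * P"], goal_cases)
      case (1 x)
      then show ?case using i answer_bits by blast
    next
      case 2
      then show ?case using M2 by simp
    next
      case 3
      then show ?case using M2 by simp
    next
      case (4 M')
      then show ?case using M2 by (simp add: same_off_def)
    next
      case (5 x y)
      then show ?case
        using affordable_antimono[OF i, of x y P R j] by (simp add: affordable_def cost_oracle_def mult.commute)
    next
      case (6 M3)
      have M3: "M3 0 0 = n" "M3 item_reg 0 = i" "M3 units_reg 0 = j"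
        and eq: "\<And>a. a \<in> {table_reg, units_choice_reg, amount_choice_reg} \<Longrightarrow> M3 a = M2 a"
        using 6(1) M2 by (auto simp: same_off_def)
      have low: "M3 low_reg 0 \<le> Suc m" "\<forall>x\<le>m. affordable f P R i x j \<longleftrightarrow> x < M3 low_reg 0"
        using 6 by (auto simp: affordable_def cost_oracle_def mult.commute)
      let ?Q = "\<lambda>M'. table_correct f m K P R (upd M' units_reg 0 (Suc j)) i \<and>
         (\<forall>c\<le>K. entry_sound f m K P R (upd M' units_reg 0 (Suc j)) i c \<and>
            entry_complete f m K P R (upd M' units_reg 0 (Suc j)) (Suc j) i c)"
      have "prog_wp (For budget_reg (Sub (width_exp k) (Var units_reg)) (relax k))
        ((K + 1 - j) * ((1 + (1 + (1 + 1))) + 2) + 2) ?Q M3"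
      proof (rule wp_For[where I = "relax_inv f m K P R i j"], goal_cases)
        case 1
        then show ?case by simp
      next
        case (2 M')
        then show ?case using M3 by (simp add: same_off_def)
      next
        case 3
        have "entry_complete f m K P R M2 (if c < j then Suc j else j) i c" if "c \<le> K" for c
          using 4(2) that by (auto simp: entry_complete_def less_Suc_eq)
        moreover have "table_correct f m K P R M3 i" using 4(2) eq by (subst table_correct_cong[of _ _ _ M2]) auto
        moreover have "entry_sound f m K P R M3 i c \<longleftrightarrow> entry_sound f m K P R M2 i c"
          "entry_complete f m K P R M3 J i c \<longleftrightarrow> entry_complete f m K P R M2 J i c" for J c
          by (simp_all add: entry_sound_def entry_complete_def eq)
        ultimately show ?case using 4(2) by (simp add: relax_inv_def)
      next
        case (4 z M')
        then have "M' 0 0 = n" "M' item_reg 0 = i" "M' units_reg 0 = j" "M' budget_reg 0 = z"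
          "M' low_reg 0 = M3 low_reg 0" using M3 by (auto simp: same_off_def)
        with 4 low show ?case
          by (intro wp_relax[where K = K and P = P and R = R and f = f and m = m])
            (auto simp: relax_inv_def)
      next
        case (5 M')
        \<comment> \<open>The starting budgets from 0 to \<open>K - j\<close> reach all columns from
          \<open>j\<close> to \<open>K\<close>.\<close>
        have "c < j + (K + 1 - j)" if "c \<le> K" for c using that \<open>j < K + 1\<close> by simp
        with 5(1) show ?case
          by (simp add: relax_inv_def)
      qed
      then show ?case by (rule wp_le) simp
    qed
  next
    case (5 M')
    then have "table_correct f m K P R M' (Suc i)"
      by (simp add: table_correct_def less_Suc_eq)
    moreover have "same_off (modified (fill_row k)) M M'"
      using S1 5(3) by (rule same_off_trans) auto
    ultimately show ?case using post by blast
  qed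
qed

end

definition table_steps :: "'a::comm_semiring_1 \<Rightarrow> 'a \<Rightarrow> 'a \<Rightarrow> 'a" where
  "table_steps l w b = (w * (1 + 2) + 2) + (l * (row_steps w b + 2) + 2)"

section \<open>Reconstruction of a solution and programs around the table\<close>

definition rebuild :: "nat \<Rightarrow> com" where
  "rebuild k = (let a = cell_exp k (Sub n_exp (Var item_reg)) (Sub (budget_exp k) (Var budget_reg)) in
     Seq (Assign budget_reg (Const 0))
     (For item_reg n_exp
       (Seq (Store 1 (Sub (Sub n_exp (Const 1)) (Var item_reg)) (Load amount_choice_reg a))
         (Assign budget_reg (Add (Var budget_reg) (Load units_choice_reg a))))))"

lemma stores_mult_free_rebuild [simp]: "stores_mult_free (rebuild k)"
  by (simp add: rebuild_def Let_def)

definition rebuild_steps :: "'a::comm_semiring_1 \<Rightarrow> 'a" where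
  "rebuild_steps l = 1 + (l * ((1 + 1) + 2) + 2)"

text \<open>Bounds the finite values from above by \<open>top_reg\<close> and the nonzero ones from below by the reciprocal
  of \<open>den_reg\<close>: one summand per item is the numerator of its largest finite value and the denominator of
  its smallest nonzero value, respectively.\<close>

definition prepare :: com where
  "prepare =
     Seq (Assign den_reg (Const 1))
     (For item_reg n_exp
       (Seq (search (Const 1) (Const 0) (Const 0))
       (Seq (Query answer_reg (Var item_reg) (Sub (Var low_reg) (Sub (Var low_reg) m_exp)))
       (Seq (Assign den_reg (Add (Var den_reg) (Load answer_reg (Const 1))))
       (Seq (search (Const 0) (Const 1) (Const 1))
       (Seq (Query answer_reg (Var item_reg) (Sub (Var low_reg) (Const 1)))
         (Assign top_reg (Add (Var top_reg) (Load answer_reg (Const 0))))))))))"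

lemma modified_prepare [simp]: "modified prepare =
    {item_reg, low_reg, high_reg, mid_reg, answer_reg, den_reg, top_reg}"
  by (auto simp: prepare_def)

lemma stores_mult_free_prepare [simp]: "stores_mult_free prepare"
  by (simp add: prepare_def)

definition prepare_steps :: "'a::comm_semiring_1 \<Rightarrow> 'a \<Rightarrow> 'a" where
  "prepare_steps l b = 1 + (l * ((search_steps b + (1 + (1 + (search_steps b + (1 + 1))))) + 2) + 2)"

text \<open>Applied to sums over the items of numbers below \<open>2 ^ L\<close>. The crude estimate
  \<open>l < 2 ^ l\<close> is good enough because \<open>n\<close> itself is a size
  parameter.\<close>

lemma bits_le_of_le_mult_power: "a \<le> 1 + l * 2 ^ L \<Longrightarrow> bits a \<le> l + L + 1"
proof -
  assume "a \<le> 1 + l * 2 ^ L"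
  also have "l * 2 ^ L < 2 ^ l * 2 ^ L" by simp
  finally have "a < 1 + 2 ^ l * 2 ^ L" by simp
  moreover have "(1 :: nat) \<le> 2 ^ l * 2 ^ L" by simp
  ultimately have "a < 2 * (2 ^ l * 2 ^ L)" by linarith
  then show ?thesis by (simp add: bits_le_iff power_add mult.commute)
qed

context knapsack_cover
begin

lemma wp_fill_table:
  assumes M: "M 0 0 = n" "M 0 1 = m" "M num_reg 0 = P" "M den_reg 0 * (K + 1) = R"
    and post: "\<And>M'. same_off (modified (fill_table k)) M M' \<Longrightarrow> table_correct f m K P R M' n \<Longrightarrow> Q M'"
  shows "prog_wp (fill_table k) (table_steps n (K + 1) (bits (Suc m))) Q M"
  unfolding fill_table_def table_steps_def
proof (rule wp_Seq, rule wp_For[where I = "\<lambda>z M'. \<forall>c<z. M' table_reg (cell K 0 c) = 1"], goal_cases)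
  case 1
  then show ?case by simp
next
  case (2 M')
  then show ?case by (simp add: same_off_def M)
next
  case 3
  then show ?case by simp
next
  case (4 z M')
  have M': "M' 0 0 = n" using 4 M by (auto simp: same_off_def)
  show ?case
    using 4 by (intro wp_Store) (auto simp: M' cell_eq_iff less_Suc_eq)
next
  case (5 M1)
  have M1: "M1 0 0 = n" "M1 0 (Suc 0) = m" "M1 num_reg 0 = P" "M1 den_reg 0 * (K + 1) = R"
    using 5(3) M by (auto simp: same_off_def)
  have S1: "same_off (modified (fill_table k)) M M1" using 5(3) by (simp add: same_off_def)
  show ?case
  proof (rule wp_For[where I = "\<lambda>z M'. table_correct f m K P R M' z"], goal_cases)
    case 1
    then show ?case by simp
  next
    case (2 M')
    then show ?case by (simp add: same_off_def M1)
  next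
    case 3
    then show ?case using 5(1) by (simp add: table_correct_def)
  next
    case (4 i M')
    show ?case
    proof (rule wp_fill_row[where i = i and P = P and R = R])
      show "M' 0 0 = n" "M' 0 1 = m" "M' num_reg 0 = P" "M' den_reg 0 * (K + 1) = R"
        using 4(4) M1 by (auto simp: same_off_def)
    qed (use 4 in auto)
  next
    case (5 M')
    moreover have "same_off (modified (fill_table k)) M M'"
      using S1 5(3) by (rule same_off_trans) auto
    ultimately show ?case using post by blast
  qed
qed

text \<open>Completeness of the rows lets the entries dominate the prefix sums of any affordable
  solution, by induction on the prefix. In contrapositive form, a small last entry proves that the
  scale fails.\<close>

lemma coverable_imp_table_entry_gt:
  assumes tc: "table_correct f m K P R M n" and cov: "coverable n m D f K P R"
  shows "D < M table_reg (cell K n K)"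
proof -
  obtain x js where x: "x \<in> feasible n m D" and js: "\<And>i. i < n \<Longrightarrow> affordable f P R i (x i) (js i)"
    "(\<Sum>i<n. js i) \<le> K"
    using cov by (auto simp: coverable_def)
  have "1 + (\<Sum>i<l. x i) \<le> M table_reg (cell K l c)" if "l \<le> n" "c \<le> K" "(\<Sum>i<l. js i) \<le> c" for l c
    using that
  proof (induction l arbitrary: c)
    case 0
    then show ?case using tc by (simp add: table_correct_def)
  next
    case (Suc l)
    have IH: "1 + (\<Sum>i<l. x i) \<le> M table_reg (cell K l (c - js l))"
      using Suc.prems by (intro Suc.IH) auto
    have "entry_complete f m K P R M (Suc K) l c"
      using tc Suc.prems by (simp add: table_correct_def)
    then have "M table_reg (cell K l (c - js l)) + x l \<le> M table_reg (cell K (Suc l) c)"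
      unfolding entry_complete_def
      using Suc.prems js(1)[of l] feasible_le[OF x, of l] IH by auto
    with IH show ?case by simp
  qed
  from this[of n K] js(2) x show ?thesis by (simp add: feasible_def)
qed

text \<open>Items are visited from last to first along the back pointers. The entry for all items
  and the full budget always equals the current entry plus the amounts already written. The walk
  ends in row 0, where entries are 1, so the amounts written add up to at least
  \<open>D\<close>.\<close>

lemma wp_rebuild:
  assumes M: "M 0 0 = n" and tc: "table_correct f m K P R M n" and D: "D < M table_reg (cell K n K)"
    and post: "\<And>M' js. output_vec n M' \<in> feasible n m D \<Longrightarrow>
      (\<And>i. i < n \<Longrightarrow> affordable f P R i (output_vec n M' i) (js i)) \<Longrightarrow> (\<Sum>i<n. js i) \<le> K \<Longrightarrow> Q M'"
  shows "prog_wp (rebuild k) (rebuild_steps n) Q M"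
proof -
  let ?T = "\<lambda>i c. M table_reg (cell K i c)"
  let ?I = "\<lambda>z M'. \<exists>js. M' budget_reg 0 = (\<Sum>i=n-z..<n. js i) \<and> M' budget_reg 0 \<le> K \<and>
    (\<forall>i\<in>{n-z..<n}. M' 1 i \<le> m \<and> affordable f P R i (M' 1 i) (js i)) \<and>
    0 < ?T (n - z) (K - M' budget_reg 0) \<and>
    ?T n K = ?T (n - z) (K - M' budget_reg 0) + (\<Sum>i=n-z..<n. M' 1 i)"
  show ?thesis
    unfolding rebuild_def rebuild_steps_def Let_def
  proof (intro wp_Seq wp_Store, rule wp_For[where I = ?I], goal_cases)
    case 1
    then show ?case by simp
  next
    case (2 M')
    then show ?case by (simp add: same_off_def M)
  next
    case 3
    then show ?case using D by auto
  next
    case (4 z M')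
    have M': "M' 0 0 = n" "M' amount_choice_reg = M amount_choice_reg"
      "M' units_choice_reg = M units_choice_reg"
      using 4(4) M by (auto simp: same_off_def)
    define l where "l = n - Suc z"
    have l: "n - z = Suc l" "n - Suc z = l" "l < n" using 4(1) by (auto simp: l_def)
    define c where "c = K - M' budget_reg 0"
    define j where "j = M units_choice_reg (cell K (Suc l) c)"
    define x where "x = M amount_choice_reg (cell K (Suc l) c)"
    obtain js where js: "M' budget_reg 0 = (\<Sum>i=Suc l..<n. js i)" "M' budget_reg 0 \<le> K"
      "\<And>i. i \<in> {Suc l..<n} \<Longrightarrow> M' 1 i \<le> m \<and> affordable f P R i (M' 1 i) (js i)"
      "0 < ?T (Suc l) c" "?T n K = ?T (Suc l) c + (\<Sum>i=Suc l..<n. M' 1 i)"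
      using 4(2) unfolding l(1) c_def by auto
    have "c \<le> K" by (simp add: c_def)
    then have "entry_sound f m K P R M l c" using tc l(3) by (simp add: table_correct_def)
    then have e: "j \<le> c" "x \<le> m" "affordable f P R l x j" "0 < ?T l (c - j)" "?T (Suc l) c = ?T l (c - j) + x"
      using js(4) by (auto simp: entry_sound_def Let_def j_def x_def)
    define N where "N = upd (upd (upd M' 1 l x) budget_reg 0 (M' budget_reg 0 + j)) item_reg 0 (Suc z)"
    have N: "N budget_reg 0 = M' budget_reg 0 + j" "N 1 l = x" "\<And>i. i \<noteq> l \<Longrightarrow> N 1 i = M' 1 i"
      by (auto simp: N_def)
    have ivl: "{l..<n} = insert l {Suc l..<n}" using l(3) by auto
    have item: "N 1 i \<le> m \<and> affordable f P R i (N 1 i) ((js(l := j)) i)" if "i \<in> {l..<n}" for i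
    proof (cases "i = l")
      case True
      then show ?thesis using e(2,3) N(2) by simp
    next
      case False
      with that have "i \<in> {Suc l..<n}" by simp
      from js(3)[OF this] False N(3)[OF False] show ?thesis by simp
    qed
    have "?I (Suc z) N"
    proof (intro exI[of _ "js(l := j)"] conjI ballI)
      show "N budget_reg 0 = (\<Sum>i=n - Suc z..<n. (js(l := j)) i)"
        using js(1) by (simp add: N l(2) ivl)
      show "N budget_reg 0 \<le> K" using e(1) js(2) by (simp add: N c_def)
      show "N 1 i \<le> m" "affordable f P R i (N 1 i) ((js(l := j)) i)" if "i \<in> {n - Suc z..<n}" for i
        using item that unfolding l(2) by blast+
      have eq: "K - N budget_reg 0 = c - j" by (simp add: N c_def)
      show "0 < ?T (n - Suc z) (K - N budget_reg 0)" unfolding eq l(2) by (rule e(4))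
      have "(\<Sum>i=Suc l..<n. N 1 i) = (\<Sum>i=Suc l..<n. M' 1 i)" using N(3) by (intro sum.cong) auto
      then show "?T n K = ?T (n - Suc z) (K - N budget_reg 0) + (\<Sum>i=n - Suc z..<n. N 1 i)"
        using js(5) e(5) N(2) unfolding eq l(2) ivl by simp
    qed
    moreover have "n - 1 - z = l" using l by simp
    moreover have "n - Suc z = l" "n - Suc 0 - z = l" using l by simp_all
    ultimately show ?case
      using 4(3) by (intro wp_Seq wp_Store) (simp add: M' N_def l x_def j_def c_def)
  next
    case (5 M')
    obtain js where js: "M' budget_reg 0 = (\<Sum>i<n. js i)" "M' budget_reg 0 \<le> K"
      "\<And>i. i < n \<Longrightarrow> M' 1 i \<le> m \<and> affordable f P R i (M' 1 i) (js i)"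
      "?T n K = ?T 0 (K - M' budget_reg 0) + (\<Sum>i<n. M' 1 i)"
      using 5(1) by (auto simp: atLeast0LessThan)
    have "?T 0 (K - M' budget_reg 0) = 1" using tc by (simp add: table_correct_def)
    then have "D \<le> (\<Sum>i<n. M' 1 i)" using D js(4) by simp
    then show ?case
      using js by (intro post[of _ js]) (auto simp: output_vec_def feasible_def)
  qed
qed

section \<open>The range of the finite nonzero values\<close>

lemma fst_encode_eq_0_iff:
  assumes "i < n" "x \<le> m"
  shows "fst (encode (f i x)) = 0 \<longleftrightarrow> f i x = Fin 0"
  using inst assms
proof (cases rule: instance_value_cases)
  case 1
  then show ?thesis by simp
next
  case (2 v)
  obtain p q where "encode (Fin v) = (p, q)" "q > 0" "v = of_nat p / of_nat q"
    using 2(2) by (rule encode_FinE)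
  with 2 show ?thesis by auto
qed

lemma snd_encode_eq_0_iff:
  assumes "i < n" "x \<le> m"
  shows "snd (encode (f i x)) = 0 \<longleftrightarrow> f i x = Pinf"
  using inst assms
proof (cases rule: instance_value_cases)
  case 1
  then show ?thesis by simp
next
  case (2 v)
  obtain p q where "encode (Fin v) = (p, q)" "q > 0" "v = of_nat p / of_nat q"
    using 2(2) by (rule encode_FinE)
  with 2 show ?thesis by auto
qed

text \<open>A positive fraction is at least the reciprocal of its denominator, and by monotonicity
  the first nonzero value, at \<open>lo\<close>, is the smallest.\<close>

lemma positive_value_ge:
  assumes i: "i < n" and lo: "\<forall>x\<le>m. f i x = Fin 0 \<longleftrightarrow> x < lo"
    and x: "x \<le> m" "f i x = Fin v" "v \<noteq> 0"
  shows "1 \<le> v * of_nat (snd (encode (f i (min lo m))))"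
proof -
  have "lo \<le> x" using lo x by (auto simp: not_less[symmetric])
  then have lo': "min lo m = lo" "lo \<le> m" using x by auto
  have le: "f i lo \<le> f i x" using instance_mono[OF inst i \<open>lo \<le> x\<close> x(1)] .
  from inst i lo'(2) show ?thesis
  proof (cases rule: instance_value_cases)
    case 1
    with le x show ?thesis by simp
  next
    case (2 u)
    obtain p q where pq: "encode (Fin u) = (p, q)" "q > 0" "u = of_nat p / of_nat q"
      using 2(2) by (rule encode_FinE)
    have "u \<noteq> 0" using lo lo'(2) 2 by auto
    then have "p \<ge> 1" using pq(3) by (cases p) auto
    then have "1 \<le> u * of_nat q" using pq(2,3) by simp
    also have "\<dots> \<le> v * of_nat q" using le 2 x by (intro mult_right_mono) auto
    finally show ?thesis by (simp only: lo'(1) 2(1) pq(1) snd_conv)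
  qed
qed

text \<open>A fraction is at most its numerator, and by monotonicity the last finite value, at
  \<open>lo - 1\<close>, is the largest.\<close>

lemma finite_value_le:
  assumes i: "i < n" and lo: "lo \<le> Suc m" "\<forall>x\<le>m. f i x \<noteq> Pinf \<longleftrightarrow> x < lo"
    and x: "x \<le> m" "f i x = Fin v"
  shows "v \<le> of_nat (fst (encode (f i (lo - 1))))"
proof -
  have "x < lo" using lo x by auto
  then have lo': "x \<le> lo - 1" "lo - 1 \<le> m" "lo - 1 < lo" using lo by auto
  have le: "f i x \<le> f i (lo - 1)" using instance_mono[OF inst i lo'(1,2)] .
  from inst i lo'(2) show ?thesis
  proof (cases rule: instance_value_cases)
    case 1
    with lo lo' show ?thesis by blast
  next
    case (2 u)
    obtain p q where pq: "encode (Fin u) = (p, q)" "q > 0" "u = of_nat p / of_nat q"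
      using 2(2) by (rule encode_FinE)
    have "v \<le> u" using le 2 x by simp
    also have "u \<le> of_nat p / 1"
      unfolding pq(3) using pq(2) by (intro divide_left_mono) auto
    finally show ?thesis by (simp only: 2(1) pq(1) fst_conv div_by_1)
  qed
qed

definition calibrated :: "nat \<Rightarrow> nat \<Rightarrow> nat \<Rightarrow> bool" where
  "calibrated l q u \<longleftrightarrow> 0 < q \<and> q \<le> 1 + l * 2 ^ L \<and> u \<le> l * 2 ^ L \<and>
     (\<forall>i x v. i < l \<longrightarrow> x \<le> m \<longrightarrow> f i x = Fin v \<longrightarrow> (v \<noteq> 0 \<longrightarrow> 1 \<le> v * of_nat q) \<and> v \<le> of_nat u)"

text \<open>Increasing \<open>q\<close> or \<open>u\<close> preserves the estimates already
  obtained. So plain sums can replace maxima and common denominators, and they stay short without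
  any stored product.\<close>

lemma calibrated_Suc:
  assumes cal: "calibrated l q u" and l: "l < n"
    and lo: "\<forall>x\<le>m. f l x = Fin 0 \<longleftrightarrow> x < lo"
    and hi: "hi \<le> Suc m" "\<forall>x\<le>m. f l x \<noteq> Pinf \<longleftrightarrow> x < hi"
  shows "calibrated (Suc l) (q + snd (encode (f l (min lo m)))) (u + fst (encode (f l (hi - 1))))"
proof -
  let ?q = "snd (encode (f l (min lo m)))" and ?u = "fst (encode (f l (hi - 1)))"
  have "bits ?q \<le> L" "bits ?u \<le> L"
    using answer_bits[OF l, of "min lo m"] answer_bits[OF l, of "hi - 1"] hi(1)
    by (auto simp: cost_oracle_def)
  then have "?q < 2 ^ L" "?u < 2 ^ L" by (simp_all add: bits_le_iff)
  moreover have "1 \<le> v * of_nat (q + ?q)" if "i < Suc l" "x \<le> m" "f i x = Fin v" "v \<noteq> 0" for i x v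
  proof -
    have "i < n" using that l by simp
    then have "0 \<le> v" using instance_nonneg[OF inst _ that(2), of i] that(3) by (simp add: zero_extended_def)
    then have *: "0 \<le> v * of_nat q" "0 \<le> v * of_nat ?q" by simp_all
    have "1 \<le> v * of_nat q \<or> 1 \<le> v * of_nat ?q"
    proof (cases "i = l")
      case True
      then show ?thesis using that positive_value_ge[OF l lo] by blast
    next
      case False
      then have "i < l" using that by simp
      then show ?thesis using that cal unfolding calibrated_def by blast
    qed
    with * show ?thesis by (auto simp: algebra_simps)
  qed
  moreover have "v \<le> of_nat (u + ?u)" if "i < Suc l" "x \<le> m" "f i x = Fin v" for i x v
  proof -
    have "v \<le> of_nat u \<or> v \<le> of_nat ?u"
    proof (cases "i = l")
      case True
      then show ?thesis using that finite_value_le[OF l hi] by blast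
    next
      case False
      then have "i < l" using that by simp
      then show ?thesis using that cal unfolding calibrated_def by blast
    qed
    then show ?thesis by (auto intro: order_trans)
  qed
  ultimately show ?thesis using cal by (auto simp: calibrated_def)
qed

lemma wp_prepare:
  assumes M: "M 0 0 = n" "M 0 1 = m" "M top_reg 0 = 0"
    and post: "\<And>M'. same_off (modified prepare) M M' \<Longrightarrow> calibrated n (M' den_reg 0) (M' top_reg 0) \<Longrightarrow> Q M'"
  shows "prog_wp prepare (prepare_steps n (bits (Suc m))) Q M"
  unfolding prepare_def prepare_steps_def
proof (rule wp_Seq, rule wp_Store, rule wp_For[where I = "\<lambda>z M'. calibrated z (M' den_reg 0) (M' top_reg 0)"], goal_cases)
  case 1
  then show ?case by simp
next
  case (2 M')
  then show ?case by (simp add: same_off_def M)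
next
  case 3
  then show ?case using M by (simp add: calibrated_def)
next
  case (4 i M1)
  have M1: "M1 0 0 = n" "M1 0 (Suc 0) = m" using 4(4) M by (auto simp: same_off_def)
  have i: "i < n" by fact
  show ?case
  proof (rule wp_Seq, rule wp_search[where m = m and i = i and a = 1 and b = 0 and c = 0], goal_cases)
    case (1 x)
    then show ?case using answer_bits[OF i] by blast
  next
    case 2
    then show ?case using M1 by simp
  next
    case 3
    then show ?case using 4 by simp
  next
    case (4 M')
    then show ?case by simp
  next
    case (5 x y)
    \<comment> \<open>With \<open>P = 0\<close>, \<open>R = 1\<close> and \<open>j = 0\<close>,
      being affordable means having value zero.\<close>
    then show ?case
      using affordable_antimono[OF i, of x y 0 1 0] by (simp add: affordable_def cost_oracle_def)
  next
    case (6 M2)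
    define lo where "lo = M2 low_reg 0"
    have M2: "M2 0 0 = n" "M2 0 (Suc 0) = m" "M2 item_reg 0 = i" "M2 den_reg = M1 den_reg" "M2 top_reg = M1 top_reg"
      using 6(1) M1 4(3) by (auto simp: same_off_def)
    have lo: "\<forall>x\<le>m. f i x = Fin 0 \<longleftrightarrow> x < lo"
      using 6(3) fst_encode_eq_0_iff[OF i] by (simp add: cost_oracle_def lo_def)
    \<comment> \<open>If all values are zero, \<open>lo\<close> is \<open>m + 1\<close>; the minimum
      keeps the query inside the domain.\<close>
    have min: "lo - (lo - m) = min lo m" by auto
    obtain p q where pq: "encode (f i (min lo m)) = (p, q)" by fastforce
    have pqL: "bits p \<le> L" "bits q \<le> L"
      using answer_bits[OF i, of "min lo m"] pq by (auto simp: cost_oracle_def)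
    show ?case
    proof (rule wp_Seq, rule wp_Query[OF _ pqL])
      show "cost_oracle f (aval (Var item_reg) M2) (aval (Sub (Var low_reg) (Sub (Var low_reg) m_exp)) M2) = (p, q)"
        using M2 pq by (simp add: cost_oracle_def min lo_def[symmetric])
    next
      let ?M3 = "upd (upd M2 answer_reg 0 p) answer_reg 1 q"
      let ?M4 = "upd ?M3 den_reg (aval (Const 0) ?M3) (aval (Add (Var den_reg) (Load answer_reg (Const 1))) ?M3)"
      have M4: "?M4 0 = M2 0" "?M4 item_reg = M2 item_reg" "?M4 den_reg 0 = M1 den_reg 0 + q" "?M4 top_reg = M1 top_reg"
        using M2 by simp_all
      define M4 where "M4 = ?M4"
      note M4 = M4[folded M4_def]
      show "prog_wp (Seq (Assign den_reg (Add (Var den_reg) (Load answer_reg (Const 1))))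
       (Seq (search (Const 0) (Const 1) (Const 1))
       (Seq (Query answer_reg (Var item_reg) (Sub (Var low_reg) (Const 1)))
         (Assign top_reg (Add (Var top_reg) (Load answer_reg (Const 0)))))))
        (1 + (search_steps (bits (Suc m)) + (1 + 1)))
        (\<lambda>M''. calibrated (Suc i) (upd M'' item_reg 0 (Suc i) den_reg 0) (upd M'' item_reg 0 (Suc i) top_reg 0)) ?M3"
      proof (rule wp_Seq, rule wp_Store, fold M4_def, rule wp_Seq,
          rule wp_search[where m = m and i = i and a = 0 and b = 1 and c = 1], goal_cases)
        case (1 x)
        then show ?case using answer_bits[OF i] by blast
      next
        case 2
        then show ?case using M2 M4 by simp
      next
        case 3
        then show ?case using M2 M4 by simp
      next
        case (4 M')
        then show ?case by simp
      next
        case (5 x y)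
        then have "f i x \<le> f i y" using instance_mono[OF inst i] by blast
        then show ?case
          using 5 snd_encode_eq_0_iff[OF i, of x] snd_encode_eq_0_iff[OF i, of y]
          by (auto simp: cost_oracle_def Suc_le_eq)
      next
        case (6 M5)
        define hi where "hi = M5 low_reg 0"
        have M5: "M5 item_reg 0 = i" "M5 den_reg 0 = M1 den_reg 0 + q" "M5 top_reg = M1 top_reg"
          using 6(1) M2 M4 by (auto simp: same_off_def)
        have hi: "hi \<le> Suc m" "\<forall>x\<le>m. f i x \<noteq> Pinf \<longleftrightarrow> x < hi"
          using 6(2,3) snd_encode_eq_0_iff[OF i] by (auto simp: cost_oracle_def hi_def Suc_le_eq)
        \<comment> \<open>If no amount has a finite value, \<open>hi - 1\<close> is 0 and the answer
          encodes infinity; its numerator 1 merely enlarges the upper bound.\<close>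
        obtain p' q' where pq': "encode (f i (hi - 1)) = (p', q')" by fastforce
        have pqL': "bits p' \<le> L" "bits q' \<le> L"
          using answer_bits[OF i, of "hi - 1"] pq' hi by (auto simp: cost_oracle_def)
        have "calibrated (Suc i) (M1 den_reg 0 + q) (M1 top_reg 0 + p')"
          using calibrated_Suc[OF 4(2) i lo hi] pq pq' by simp
        then show ?case
          using M5 pq' by (intro wp_Seq wp_Query[OF _ pqL'] wp_Store) (simp_all add: cost_oracle_def hi_def)
      qed
    qed
  qed
next
  case (5 M')
  then show ?case by (intro post) (auto simp: same_off_def)
qed

end


section \<open>Doubling the scale\<close>

text \<open>The outer test asks whether the largest amount reaches \<open>D\<close>, the inner one
  whether the scale is still at most \<open>top_reg\<close>. If it is not, a zero denominator makes
  the next scale infinite.\<close>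

definition try_scale :: "nat \<Rightarrow> com" where
  "try_scale k =
     Seq (fill_table k)
     (Ite (Sub (Load table_reg (cell_exp k n_exp (budget_exp k))) D_exp)
       (Assign continue_reg (Const 0))
       (Ite (Sub (Add (Mul (Var top_reg) (Mul (Var den_reg) (width_exp k))) (Const 1)) (Var num_reg))
         (Assign num_reg (Add (Var num_reg) (Var num_reg)))
         (Assign den_reg (Const 0))))"

definition algorithm :: "nat \<Rightarrow> com" where
  "algorithm k =
     Seq prepare
     (Seq (Assign num_reg (Const 1))
     (Seq (Assign continue_reg (Const 1))
     (Seq (While (Var continue_reg) (try_scale k))
       (rebuild k))))"

lemma modified_try_scale [simp]: "modified (try_scale k) =
    {item_reg, units_reg, budget_reg, low_reg, high_reg, mid_reg, answer_reg, den_reg, num_reg, continue_reg,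
     table_reg, units_choice_reg, amount_choice_reg}"
  by (auto simp: try_scale_def)

lemma stores_mult_free_algorithm [simp]: "stores_mult_free (algorithm k)"
  by (simp add: algorithm_def try_scale_def)

definition algorithm_steps :: "'a::comm_semiring_1 \<Rightarrow> 'a \<Rightarrow> 'a \<Rightarrow> 'a \<Rightarrow> 'a" where
  "algorithm_steps l w b t =
     prepare_steps l b + (1 + (1 + ((t * (1 + (table_steps l w b + (1 + (1 + 1)))) + 1) + rebuild_steps l)))"

lemma algorithm_steps_mono:
  fixes l w b t :: nat
  assumes "l \<le> l'" "w \<le> w'" "b \<le> b'" "t \<le> t'"
  shows "algorithm_steps l w b t \<le> algorithm_steps l' w' b' t'"
  unfolding algorithm_steps_def prepare_steps_def table_steps_def row_steps_def rebuild_steps_def search_steps_def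
  using assms by (intro add_mono mult_le_mono order_refl)

lemma poly_algorithm_steps:
  fixes l w b t :: "nat poly"
  shows "poly (algorithm_steps l w b t) s = algorithm_steps (poly l s) (poly w s) (poly b s) (poly t s)"
  by (simp only: algorithm_steps_def prepare_steps_def table_steps_def row_steps_def rebuild_steps_def
      search_steps_def poly_add poly_mult poly_1 poly_numeral)

context knapsack_cover
begin

text \<open>What is known about a scale \<open>P / (d * (K + 1))\<close> when it is tried, where \<open>q\<close> and \<open>u\<close> are the
  numbers computed by \<open>prepare\<close>: it is the smallest scale, or half of it has failed, or it is infinite
  because a scale larger than all finite values has failed.\<close>

definition scale_history :: "nat \<Rightarrow> nat \<Rightarrow> nat \<Rightarrow> nat \<Rightarrow> bool" where
  "scale_history q u P d \<longleftrightarrow> 0 < P \<and>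
     ((d = q \<and> P = 1) \<or>
      (d = q \<and> (\<exists>P'>0. P = 2 * P' \<and> \<not> coverable n m D f K P' (q * (K + 1)))) \<or>
      (d = 0 \<and> (\<exists>P'. \<not> coverable n m D f K P' (q * (K + 1)) \<and> u * (q * (K + 1)) < P')))"

text \<open>Each kind of scale has its own guarantee. At the infinite scale it comes from the
  earlier failure: the optimum is infinite, so every feasible vector is good enough.\<close>

lemma approx_solution_scale_history:
  assumes cal: "calibrated n q u" and hist: "scale_history q u P d"
    and x: "x \<in> feasible n m D"
    and w: "\<And>i. i < n \<Longrightarrow> affordable f P (d * (K + 1)) i (x i) (js i)" and js: "(\<Sum>i<n. js i) \<le> K"
    and k: "k \<ge> 2" and r: "2 * real k \<le> r * (real k - 1)"
  shows "approx_solution r n m D f x"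
proof -
  have q: "0 < q" using cal by (simp add: calibrated_def)
  have "0 \<le> r * (real k - 1)" using r by (rule order_trans[rotated]) simp
  then have r0: "0 \<le> r" using k by (simp add: zero_le_mult_iff)
  from hist consider "d = q" "P = 1"
    | P' where "d = q" "P' > 0" "P = 2 * P'" "\<not> coverable n m D f K P' (q * (K + 1))"
    | P' where "\<not> coverable n m D f K P' (q * (K + 1))" "u * (q * (K + 1)) < P'"
    unfolding scale_history_def by blast
  then show ?thesis
  proof cases
    case 1
    then show ?thesis
      using w js q r0 cal
      by (intro approx_solution_smallest_scale[OF inst x, where R = "q * (K + 1)" and Q = q and K = K and js = js])
        (auto simp: calibrated_def)
  next
    case (2 P')
    then show ?thesis
      using w js q k r
      by (intro approx_solution_doubled_scale[OF inst x, where R = "q * (K + 1)" and P = P' and k = k and js = js])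
        auto
  next
    case (3 P')
    then show ?thesis
      using cal k
      by (intro approx_solution_infinite[OF inst x 3(1,2)]) (auto simp: calibrated_def)
  qed
qed

text \<open>The three outcomes are kept apart because the measure of the main loop decreases for a
  different reason in each.\<close>

lemma wp_try_scale:
  assumes M: "M 0 0 = n" "M 0 1 = m" "M 0 2 = D" "M top_reg 0 = u"
    and q: "0 < q" and hist: "scale_history q u (M num_reg 0) (M den_reg 0)"
    and stop: "\<And>M'. scale_history q u (M' num_reg 0) (M' den_reg 0) \<Longrightarrow> M' continue_reg 0 = 0 \<Longrightarrow>
      table_correct f m K (M' num_reg 0) (M' den_reg 0 * (K + 1)) M' n \<Longrightarrow>
      D < M' table_reg (cell K n K) \<Longrightarrow> Q M'"
    and double: "\<And>M'. scale_history q u (M' num_reg 0) (M' den_reg 0) \<Longrightarrow>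
      M den_reg 0 = q \<Longrightarrow> M num_reg 0 \<le> u * (q * (K + 1)) \<Longrightarrow>
      M' num_reg 0 = M num_reg 0 + M num_reg 0 \<Longrightarrow> M' den_reg 0 = q \<Longrightarrow>
      M' continue_reg = M continue_reg \<Longrightarrow> Q M'"
    and unbounded: "\<And>M'. scale_history q u (M' num_reg 0) (M' den_reg 0) \<Longrightarrow>
      M den_reg 0 = q \<Longrightarrow> M' den_reg 0 = 0 \<Longrightarrow> M' continue_reg = M continue_reg \<Longrightarrow> Q M'"
  shows "prog_wp (try_scale k) (table_steps n (K + 1) (bits (Suc m)) + (1 + (1 + 1))) Q M"
  unfolding try_scale_def
proof (rule wp_Seq, rule wp_fill_table[where M = M, OF M(1,2) refl refl], goal_cases)
  case (1 M')
  define P where "P = M num_reg 0"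
  have M': "M' 0 = M 0" "M' num_reg = M num_reg" "M' den_reg = M den_reg" "M' top_reg = M top_reg"
    "M' continue_reg = M continue_reg"
    using 1(1) by (auto simp: same_off_def)
  have inp: "M 0 (Suc 0) = m" "k * M 0 0 = K" using M by simp_all
  show ?case
  proof (rule wp_Ite, goal_cases)
    case 1
    then have "D < M' table_reg (cell K n K)" by (simp add: M' M inp)
    then show ?case
      using \<open>table_correct f m K _ _ M' n\<close> hist
      by (intro wp_le[OF wp_Store] stop) (simp_all add: M')
  next
    case 2
    then have le: "M' table_reg (cell K n K) \<le> D" by (simp add: M' M inp)
    have fail: "\<not> coverable n m D f K P (M den_reg 0 * (K + 1))"
      using coverable_imp_table_entry_gt[OF \<open>table_correct f m K _ _ M' n\<close>] le
      by (auto simp: P_def)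
    \<comment> \<open>The infinite scale cannot fail, so the scale that just failed still has the
      original denominator.\<close>
    have "M den_reg 0 \<noteq> 0"
      using fail coverable_unbounded[OF inst, of K P] by (metis mult_0)
    then have den: "M den_reg 0 = q" using hist by (auto simp: scale_history_def)
    have P: "P > 0" using hist by (simp add: scale_history_def P_def)
    show ?case
    proof (rule wp_Ite, goal_cases)
      case 1
      then have "P \<le> u * (q * (K + 1))" by (simp add: M' M inp den P_def)
      moreover have "scale_history q u (P + P) q"
        using fail P unfolding scale_history_def den by (auto simp: mult_2)
      ultimately show ?case
        by (intro wp_Store double) (simp_all add: M' den P_def)
    next
      case 2
      then have "u * (q * (K + 1)) < P" by (simp add: M' M inp den P_def)
      then have "scale_history q u P 0"
        using fail P unfolding scale_history_def den by auto
      then show ?case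
        by (intro wp_Store unbounded) (simp_all add: M' den P_def)
    qed
  qed
qed

lemma wp_algorithm:
  assumes k: "k \<ge> 2" and r: "2 * real k \<le> r * (real k - 1)"
  shows "prog_wp (algorithm k)
    (algorithm_steps n (K + 1) (bits (Suc m)) (2 + ((n + L + 1) + (n + L + 1) + (K + 1))))
    (\<lambda>M'. approx_solution r n m D f (output_vec n M')) (input_mem n m D)"
  unfolding algorithm_def algorithm_steps_def
proof (rule wp_Seq, rule wp_prepare, goal_cases)
  case (4 M1)
  define q u where "q = M1 den_reg 0" and "u = M1 top_reg 0"
  let ?B = "bits (u * (q * (K + 1)))"
  have cal: "calibrated n q u" using 4(2) by (simp add: q_def u_def)
  then have q: "0 < q" by (simp add: calibrated_def)
  have inp: "M1 0 0 = n" "M1 0 (Suc 0) = m" "M1 0 2 = D"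
    using 4(1) by (simp_all add: same_off_def input_mem_def)
  have "?B \<le> bits u + (bits q + bits (K + 1))"
    using bits_mult_le[of u "q * (K + 1)"] bits_mult_le[of q "K + 1"] by linarith
  also have "bits u \<le> n + L + 1" using cal by (intro bits_le_of_le_mult_power) (simp add: calibrated_def)
  also have "bits q \<le> n + L + 1" using cal by (intro bits_le_of_le_mult_power) (simp add: calibrated_def)
  also have "bits (K + 1) \<le> K + 1" by (rule bits_le_self)
  finally have B: "?B \<le> (n + L + 1) + (n + L + 1) + (K + 1)" by simp
  let ?I = "\<lambda>M'. scale_history q u (M' num_reg 0) (M' den_reg 0) \<and>
    (M' continue_reg 0 = 0 \<longrightarrow> table_correct f m K (M' num_reg 0) (M' den_reg 0 * (K + 1)) M' n \<and>
      D < M' table_reg (cell K n K))"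
  \<comment> \<open>Each doubling adds one bit to \<open>num_reg\<close>, and it happens only while
    \<open>num_reg\<close> is within the bound measured by \<open>?B\<close>. The values 1 and 0 are
    reserved for the infinite scale and for the end of the search.\<close>
  let ?v = "\<lambda>M'. if M' continue_reg 0 = 0 then 0 else if M' den_reg 0 = 0 then 1
    else 2 + (?B + 1 - bits (M' num_reg 0))"
  show ?case
  proof (intro wp_Seq wp_Store, rule wp_While[where I = ?I and v = ?v], goal_cases)
    case 1
    then show ?case by (simp add: scale_history_def q_def)
  next
    case 2
    have "bits 1 = 1" by (simp add: compute_floorlog)
    then show ?case using B q by simp
  next
    case (3 M')
    have M': "M' 0 0 = n" "M' 0 1 = m" "M' 0 2 = D" "M' top_reg 0 = u"
      using 3(3) inp by (auto simp: same_off_def u_def)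
    have cont: "M' continue_reg 0 \<noteq> 0" using 3(2) by simp
    have P: "0 < M' num_reg 0" using 3(1) by (simp add: scale_history_def)
    show ?case
    proof (rule wp_try_scale[OF M' q])
      show "scale_history q u (M' num_reg 0) (M' den_reg 0)" using 3(1) by blast
    next
      fix M2 assume *: "M' den_reg 0 = q" "M' num_reg 0 \<le> u * (q * (K + 1))"
        "M2 num_reg 0 = M' num_reg 0 + M' num_reg 0" "M2 den_reg 0 = q" "M2 continue_reg = M' continue_reg"
        "scale_history q u (M2 num_reg 0) (M2 den_reg 0)"
      have "bits (M' num_reg 0) \<le> ?B" using *(2) by (rule bits_mono)
      then have "?v M2 < ?v M'" using * cont q bits_double[OF P] by simp
      then show "?I M2 \<and> ?v M2 < ?v M'" using * cont by simp
    qed (use cont q in auto)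
  next
    case (4 M')
    have M': "M' 0 0 = n" using 4(3) inp by (auto simp: same_off_def)
    show ?case
    proof (rule wp_rebuild[where M = M' and P = "M' num_reg 0" and R = "M' den_reg 0 * (K + 1)", OF M'])
      show "table_correct f m K (M' num_reg 0) (M' den_reg 0 * (K + 1)) M' n" "D < M' table_reg (cell K n K)"
        using 4(1,2) by auto
    qed (use 4(1) approx_solution_scale_history[OF cal _ _ _ _ k r] in blast)
  qed
qed (simp_all add: input_mem_def)

end

section \<open>The polynomial time bound and the choice of the rounding parameter\<close>

lemma poly_time_approximation_algorithm:
  assumes k: "k \<ge> 2" and r: "2 * real k \<le> r * (real k - 1)"
  shows "poly_time_approximation r (algorithm k)"
proof -
  let ?X = "[:0, 1:] :: nat poly"
  define G where "G = com_size (algorithm k)"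
  define S where "S = algorithm_steps ?X ([:k:] * ?X + 1) (?X + 1)
    (2 + ((?X + 1) + (?X + 1) + ([:k:] * ?X + 1)))"
  \<comment> \<open>There are at most \<open>S\<close> steps. Each widens the memory by at most
    \<open>G\<close> bits and costs at most \<open>G\<close> times one more than the final
    width.\<close>
  define p where "p = S * ([:G:] * (1 + ?X + S * [:G:]))"
  have "\<exists>t M. exec (cost_oracle f) (algorithm k) (input_mem n m D) t M \<and>
      t \<le> poly p (n + bits m + bits D + max_value_bits n m f) \<and>
      approx_solution r n m D f (output_vec n M)"
    if inst: "nlkc_instance n m D f" for n m D f
  proof -
    interpret knapsack_cover n m D f k by unfold_locales (rule inst)
    define s where "s = n + bits m + bits D + L"
    obtain j M where j: "j \<le> algorithm_steps n (K + 1) (bits (Suc m)) (2 + ((n + L + 1) + (n + L + 1) + (K + 1)))"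
      and run: "run (cost_oracle f) L (algorithm k) (input_mem n m D) j M"
      and appr: "approx_solution r n m D f (output_vec n M)"
      using wp_algorithm[OF k r] unfolding wp_def by blast
    have "bits (m + 1) \<le> Suc (bits m)"
      by (simp only: bits_le_iff) (use bits_le_iff[of m "bits m"] in simp)
    then have "j \<le> algorithm_steps s (k * s + 1) (s + 1) (2 + ((s + 1) + (s + 1) + (k * s + 1)))"
      by (intro order_trans[OF j] algorithm_steps_mono add_mono mult_le_mono order_refl) (auto simp: s_def)
    also have "\<dots> = poly S s" by (simp add: S_def poly_algorithm_steps mult.commute)
    finally have jS: "j \<le> poly S s" .
    have "bounded_mem s (input_mem n m D)"
      using bits_le_self[of n] by (auto simp: bounded_mem_def input_mem_def s_def bits_le_iff[of 0])
    moreover have "L \<le> s" by (simp add: s_def)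
    ultimately obtain t where t: "exec (cost_oracle f) (algorithm k) (input_mem n m D) t M"
      "t \<le> j * (G * Suc (s + j * G))"
      using run_imp_exec[OF run stores_mult_free_algorithm, of G s "s + j * G"] by (auto simp: G_def)
    have "j * (G * Suc (s + j * G)) \<le> poly S s * (G * Suc (s + poly S s * G))"
      using jS by (intro mult_le_mono order_refl Suc_le_mono[THEN iffD2] add_mono)
    also have "\<dots> = poly p s" by (simp add: p_def algebra_simps)
    finally show ?thesis using t appr unfolding s_def by (meson order_trans)
  qed
  then show ?thesis unfolding poly_time_approximation_def by blast
qed

theorem theorem4:
  fixes \<epsilon> :: real
  assumes "\<epsilon> > 0"
  shows "\<exists>c. poly_time_approximation (2 + \<epsilon>) c"
proof -
  \<comment> \<open>The ratio is at most 2 + \<epsilon> as soon as 2 / \<epsilon> is at most k - 1;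
    the summand 2 also secures that \<open>k\<close> is at least 2.\<close>
  define k where "k = nat \<lceil>2 / \<epsilon>\<rceil> + 2"
  have "2 / \<epsilon> \<le> real k - 1" using real_nat_ceiling_ge[of "2 / \<epsilon>"] by (simp add: k_def)
  then have "2 * real k \<le> (2 + \<epsilon>) * (real k - 1)" using assms by (simp add: field_simps)
  moreover have "k \<ge> 2" by (simp add: k_def)
  ultimately show ?thesis using poly_time_approximation_algorithm by blast
qed

end
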